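(* Let $(M,g,\mathfrak{m})$, $\mathfrak{m}=e^{-\psi}\,\mathrm{vol}_g$, be a complete weighted Riemannian manifold of $\mathrm{Ric}_N\ge0$ for $N=\infty$ or $N\in(-\infty,-1)$, where $\psi\in C^2(M)$ is bounded from above, and let $\mu=\rho\,\mathfrak{m}\in\mathcal{P}^2(M)$ with $\rho\colon M\to[0,\infty)$. Let $x_0\in M$ be a barycenter of $\mu$ and $\gamma\colon\mathbb{R}\to M$ a straight line with $\mathbf{b}_\gamma(x_0)=0$. Let $(Q,\mathfrak{q})$, $(M_q,\mathfrak{m}_q)$ and $\mu_q=\rho\,\mathfrak{m}_q=w_q\,dx$ be the elements of the localization associated with $\mathbf{b}_\gamma\rho$ (described in the context). (i) Suppose that $N\in(-\infty,-1)$, $\rho^{1/(\beta-N)}$ is concave on $\rho^{-1}((0,\infty))$ for some $\beta\in(N,-1)$, and $$\mu(\{x\in M\mid\mathbf{b}_\gamma(x)\le0\})\le(1+\varepsilon)\Bigl(\frac{\beta}{\beta+1}\Bigr)^\beta$$ for some $\varepsilon>0$. Then, for each $\delta>0$, there exists $Q'\subset Q$ (with $\mu_q(M_q)>0$ for $q\in Q'$) such that $\mu\bigl(\bigcup_{q\in Q'}M_q\bigr)\ge\frac{\delta}{1+\delta}$ and every $q\in Q'$ satisfies $$\int_{\mathbb{R}}|R_q-F_q|\,dx\le2\beta\Bigl(\frac{\beta}{\beta+1}\Bigr)^\beta(1+\varepsilon')\bigl(1-(1+\varepsilon')^{-1/\beta}\bigr)\frac{\mu_q(M_q)}{w_q(0)},$$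 where $\varepsilon':=\varepsilon+\delta+\varepsilon\delta$, $c_q:=w_q(0)\big/\int_{-\infty}^0w_q(x)\,dx$, and $R_q$ and $F_q$ are the cumulative distribution functions of $\mu_q(M_q)^{-1}\mu_q$ and of the density $c_q\bigl(\frac{\beta}{\beta+1}\bigr)^\beta\bigl(1+\frac{c_q}{\beta}x\bigr)^{\beta-1}$ on $(-\infty,1/c_q]$, respectively. (ii) Suppose that $N=\infty$, $\log\rho$ is concave, and $$\mu(\{x\in M\mid\mathbf{b}_\gamma(x)\le0\})\le(1+\varepsilon)e^{-1}$$ for some $\varepsilon>0$. Then, for each $\delta>0$, there exists $Q'\subset Q$ (with $\mu_q(M_q)>0$ for $q\in Q'$) such that $\mu\bigl(\bigcup_{q\in Q'}M_q\bigr)\ge\frac{\delta}{1+\delta}$ and every $q\in Q'$ satisfies $$\int_{\mathbb{R}}|R_q-F_q|\,dx\le\frac{4\sqrt3}{e}(1+\varepsilon')\log(1+\varepsilon')\Bigl(\frac{1}{\mu_q(M_q)}\int_{M_q}\mathbf{b}_\gamma^2\,d\mu_q\Bigr)^{1/2},$$ where $\varepsilon':=\varepsilon+\delta+\varepsilon\delta$, $c_q:=w_q(0)\big/\int_{-\infty}^0w_q(x)\,dx$, and $R_q$ and $F_q$ are the cumulative distribution functions of $\mu_q(M_q)^{-1}\mu_q$ and of the density $c_qe^{c_qx-1}$ on $(-\infty,1/c_q]$, respectively.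
   Context: For an $n$-dimensional Riemannian manifold $(M,g)$ with $\mathfrak{m}=e^{-\psi}\mathrm{vol}_g$, $\mathrm{Ric}_N(v):=\mathrm{Ric}_g(v)+\mathrm{Hess}\,\psi(v,v)-\frac{\langle\nabla\psi,v\rangle^2}{N-n}$ for $v\in TM$, $N\in(-\infty,0]\cup(n,\infty)$, and $\mathrm{Ric}_\infty(v):=\mathrm{Ric}_g(v)+\mathrm{Hess}\,\psi(v,v)$. Let $\mathrm{d}$ be the Riemannian distance. A (minimal) geodesic is a path $\eta\colon[0,1]\to M$ with $\mathrm{d}(\eta(s),\eta(t))=|s-t|\,\mathrm{d}(\eta(0),\eta(1))$. A function $f\colon M\to\mathbb{R}\cup\{-\infty\}$ is concave if $f(\eta(t))\ge(1-t)f(\eta(0))+tf(\eta(1))$ for all such $\eta$, $t$. "$\rho^{1/(\beta-N)}$ is concave on $\rho^{-1}((0,\infty))$" means that the function equal to $\rho^{1/(\beta-N)}$ where $\rho>0$ and $-\infty$ where $\rho=0$ is concave; $\log0=-\infty$. A straight line is a map $\gamma\colon\mathbb{R}\to M$ with $\mathrm{d}(\gamma(s),\gamma(t))=|s-t|$; $\mathbf{b}_\gamma(x):=\lim_{t\to\infty}\{t-\mathrm{d}(x,\gamma(t))\}$ is its Busemann function. $\mathcal{P}^2(M)$: Borel probability measures with finite second moment. A barycenter of $\mu$ attains $\inf_{z\in M}\int_M\mathrm{d}^2(z,x)\,\mu(dx)$. Localization (Klartag's needle decomposition for $f:=\mathbf{b}_\gamma\rho$, which satisfies $\int_Mf\,d\mathfrak{m}=0$).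 Put $\Omega:=\mathrm{supp}(\mu)$. It provides a set $Z\subset M$ with $f=0$ $\mathfrak{m}$-a.e. on $Z$ ($Z$ is $\mu$-negligible here), a measure space $(Q,\mathfrak{q})$, and a decomposition of $M\setminus Z$ into needles $\{M_q\}_{q\in Q}$, each the image of a minimal geodesic (possibly of infinite length), with a probability measure $\mathfrak{m}_q$ on $M_q$, such that: $\int_\Omega\phi\,d\mathfrak{m}=\int_Q\int_{M_q}\phi\,d\mathfrak{m}_q\,\mathfrak{q}(dq)$ for all $\phi\in L^1(\mathfrak{m})$ with $\mathrm{supp}(\phi)\subset\Omega$; and for $\mathfrak{q}$-a.e. $q$, $\int_{M_q}\mathbf{b}_\gamma\rho\,d\mathfrak{m}_q=0$ and $(M_q,\mathfrak{m}_q)$ satisfies $\mathrm{CD}(0,N)$, i.e. the density $\zeta$ of $\mathfrak{m}_q$ with respect to arclength has $\log\zeta$ concave if $N=\infty$, and $\zeta^{1/(N-1)}$ convex if $N<-1$. Put $\mu_q:=\rho\,\mathfrak{m}_q$. For $\mathfrak{q}$-a.e. $q$ with $\mu_q(M_q)>0$, $M_q$ is identified with $\mathbf{b}_\gamma(M_q)\subset\mathbb{R}$ via $\mathbf{b}_\gamma$, and $\mu_q=w_q\,dx$ is written through this identification (with $w_q=0$ outside $\mathbf{b}_\gamma(M_q)$, and $w_q^{1/(\beta-1)}$ convex in case (i), $\log w_q$ concave in case (ii)). *)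

theory Defs
  imports "HOL-Probability.Distribution_Functions"
begin

section \<open>Smooth functions and tensor calculus in coordinates\<close>

definition partial :: "'n \<Rightarrow> (real^'n \<Rightarrow> real) \<Rightarrow> real^'n \<Rightarrow> real" where
  "partial i f y = frechet_derivative f (at y) (axis i 1)"

text \<open>Only used on open sets \<open>U\<close>.\<close>

primrec Ck_on :: "nat \<Rightarrow> (real^'n) set \<Rightarrow> (real^'n \<Rightarrow> real) \<Rightarrow> bool" where
  "Ck_on 0 U f \<longleftrightarrow> continuous_on U f"
| "Ck_on (Suc k) U f \<longleftrightarrow>
     (\<forall>y\<in>U. f differentiable (at y)) \<and> (\<forall>i. Ck_on k U (partial i f))"

definition smooth_on :: "(real^'n) set \<Rightarrow> (real^'n \<Rightarrow> real) \<Rightarrow> bool" where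
  "smooth_on U f \<longleftrightarrow> (\<forall>k. Ck_on k U f)"

text \<open>Christoffel symbols $\Gamma^k_{ij}$ of a metric \<open>G\<close> given as a matrix-valued function.\<close>

definition christoffel ::
    "(real^'n \<Rightarrow> real^'n^'n) \<Rightarrow> 'n \<Rightarrow> 'n \<Rightarrow> 'n \<Rightarrow> real^'n \<Rightarrow> real" where
  "christoffel G k i j y =
     (1/2) * (\<Sum>l\<in>UNIV. matrix_inv (G y) $ k $ l *
       (partial i (\<lambda>z. G z $ j $ l) y + partial j (\<lambda>z. G z $ i $ l) y
        - partial l (\<lambda>z. G z $ i $ j) y))"

text \<open>Sign convention: the Ricci tensor of a round sphere is positive.\<close>

definition ricci_tensor ::
    "(real^'n \<Rightarrow> real^'n^'n) \<Rightarrow> 'n \<Rightarrow> 'n \<Rightarrow> real^'n \<Rightarrow> real" where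
  "ricci_tensor G i j y =
     (\<Sum>k\<in>UNIV. partial k (christoffel G k i j) y - partial j (christoffel G k i k) y)
   + (\<Sum>k\<in>UNIV. \<Sum>l\<in>UNIV.
        christoffel G k k l y * christoffel G l i j y
        - christoffel G k j l y * christoffel G l i k y)"

definition hessian_tensor ::
    "(real^'n \<Rightarrow> real^'n^'n) \<Rightarrow> (real^'n \<Rightarrow> real) \<Rightarrow> 'n \<Rightarrow> 'n \<Rightarrow> real^'n \<Rightarrow> real" where
  "hessian_tensor G h i j y =
     partial i (partial j h) y - (\<Sum>k\<in>UNIV. christoffel G k i j y * partial k h y)"

text \<open>\<open>weighted_ricci N G h y v\<close> is \<open>Ric_N(v)\<close> at the point with coordinates \<open>y\<close>, for the weight
  \<open>exp (- h)\<close>; the last sum is \<open>\<langle>\<nabla>h, v\<rangle> = dh(v)\<close>.  Meaningful for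
  \<open>N \<le> 0\<close>, \<open>N > CARD('n)\<close> and \<open>N = \<infinity>\<close>.\<close>

definition weighted_ricci ::
    "ereal \<Rightarrow> (real^'n \<Rightarrow> real^'n^'n) \<Rightarrow> (real^'n \<Rightarrow> real) \<Rightarrow> real^'n \<Rightarrow> real^'n \<Rightarrow> real" where
  "weighted_ricci N G h y v =
     (\<Sum>i\<in>UNIV. \<Sum>j\<in>UNIV. (ricci_tensor G i j y + hessian_tensor G h i j y) * v $ i * v $ j)
     - (if N = \<infinity> then 0
        else (\<Sum>i\<in>UNIV. partial i h y * v $ i)\<^sup>2 / (real_of_ereal N - real CARD('n)))"


section \<open>Weighted Riemannian manifolds\<close>

text \<open>A chart is a pair of its domain and its coordinate map; only the restriction of the map to
  the domain matters.\<close>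

type_synonym ('a, 'n) chart = "'a set \<times> ('a \<Rightarrow> real^'n)"

type_synonym ('a, 'n) metric = "('a, 'n) chart \<Rightarrow> real^'n \<Rightarrow> real^'n^'n"

definition chart_inv :: "('a, 'n) chart \<Rightarrow> real^'n \<Rightarrow> 'a" where
  "chart_inv \<kappa> = inv_into (fst \<kappa>) (snd \<kappa>)"

definition smooth_atlas :: "('a::topological_space, 'n::finite) chart set \<Rightarrow> bool" where
  "smooth_atlas A \<longleftrightarrow>
     (\<Union>\<kappa>\<in>A. fst \<kappa>) = UNIV \<and>
     (\<forall>\<kappa>\<in>A. open (fst \<kappa>) \<and> open (snd \<kappa> ` fst \<kappa>) \<and>
        homeomorphism (fst \<kappa>) (snd \<kappa> ` fst \<kappa>) (snd \<kappa>) (chart_inv \<kappa>)) \<and>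
     (\<forall>\<kappa>\<in>A. \<forall>\<kappa>'\<in>A. \<forall>i.
        smooth_on (snd \<kappa> ` (fst \<kappa> \<inter> fst \<kappa>')) (\<lambda>y. snd \<kappa>' (chart_inv \<kappa> y) $ i))"

text \<open>The matrices \<open>g \<kappa> y\<close> are the coefficients of one smooth, positive definite
  (0,2)-tensor field in the charts \<open>\<kappa>\<close>.\<close>

definition smooth_metric ::
    "('a::topological_space, 'n::finite) chart set \<Rightarrow> ('a, 'n) metric \<Rightarrow> bool" where
  "smooth_metric A g \<longleftrightarrow>
     (\<forall>\<kappa>\<in>A.
        (\<forall>i j. smooth_on (snd \<kappa> ` fst \<kappa>) (\<lambda>y. g \<kappa> y $ i $ j)) \<and>
        (\<forall>y\<in>snd \<kappa> ` fst \<kappa>. transpose (g \<kappa> y) = g \<kappa> y \<and>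
           (\<forall>v. v \<noteq> 0 \<longrightarrow> v \<bullet> (g \<kappa> y *v v) > 0))) \<and>
     (\<forall>\<kappa>\<in>A. \<forall>\<kappa>'\<in>A. \<forall>y\<in>snd \<kappa> ` (fst \<kappa> \<inter> fst \<kappa>').
        let \<tau> = (\<lambda>z. snd \<kappa>' (chart_inv \<kappa> z)); J = jacobian \<tau> (at y)
        in g \<kappa> y = transpose J ** g \<kappa>' (\<tau> y) ** J)"

definition piecewise_C1_curve ::
    "('a::topological_space, 'n::finite) chart set \<Rightarrow> (real \<Rightarrow> 'a) \<Rightarrow> bool" where
  "piecewise_C1_curve A c \<longleftrightarrow>
     continuous_on {0..1} c \<and>
     (\<exists>S. finite S \<and>
        (\<forall>\<kappa>\<in>A. (snd \<kappa> \<circ> c) C1_differentiable_on {t\<in>{0<..<1} - S. c t \<in> fst \<kappa>}))"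

text \<open>The Riemannian norm of the velocity.  By the transformation law of the metric, all charts
  around \<open>c t\<close> give the same value at points of differentiability, so the choice is immaterial.\<close>

definition curve_speed ::
    "('a, 'n::finite) chart set \<Rightarrow> ('a, 'n) metric \<Rightarrow> (real \<Rightarrow> 'a) \<Rightarrow> real \<Rightarrow> real" where
  "curve_speed A g c t =
     (SOME s. \<exists>\<kappa>\<in>A. c t \<in> fst \<kappa> \<and>
        (let v = vector_derivative (snd \<kappa> \<circ> c) (at t)
         in s = sqrt (v \<bullet> (g \<kappa> (snd \<kappa> (c t)) *v v))))"

definition curve_length ::
    "('a, 'n::finite) chart set \<Rightarrow> ('a, 'n) metric \<Rightarrow> (real \<Rightarrow> 'a) \<Rightarrow> ennreal" where
  "curve_length A g c = (\<integral>\<^sup>+t\<in>{0..1}. ennreal (curve_speed A g c t) \<partial>lborel)"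

text \<open>The manifold is the whole type.  Its metric-space structure is required to be the Riemannian
  distance; finiteness of the infimum entails connectedness.\<close>

definition riemannian_manifold ::
    "('a::metric_space, 'n::finite) chart set \<Rightarrow> ('a, 'n) metric \<Rightarrow> bool" where
  "riemannian_manifold A g \<longleftrightarrow>
     smooth_atlas A \<and> smooth_metric A g \<and>
     (\<forall>x y. ennreal (dist x y) =
        (INF c\<in>{c. piecewise_C1_curve A c \<and> c 0 = x \<and> c 1 = y}. curve_length A g c))"

definition riemannian_volume ::
    "('a::metric_space, 'n::finite) chart set \<Rightarrow> ('a, 'n) metric \<Rightarrow> 'a measure \<Rightarrow> bool" where
  "riemannian_volume A g vol \<longleftrightarrow>
     sets vol = sets borel \<and>
     (\<forall>\<kappa>\<in>A. \<forall>B\<in>sets borel. B \<subseteq> fst \<kappa> \<longrightarrow>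
        emeasure vol B = (\<integral>\<^sup>+y\<in>snd \<kappa> ` B. ennreal (sqrt (det (g \<kappa> y))) \<partial>lborel))"

definition C2_on_manifold :: "('a, 'n::finite) chart set \<Rightarrow> ('a \<Rightarrow> real) \<Rightarrow> bool" where
  "C2_on_manifold A h \<longleftrightarrow> (\<forall>\<kappa>\<in>A. Ck_on 2 (snd \<kappa> ` fst \<kappa>) (h \<circ> chart_inv \<kappa>))"

definition nonneg_weighted_ricci ::
    "('a, 'n::finite) chart set \<Rightarrow> ('a, 'n) metric \<Rightarrow> ('a \<Rightarrow> real) \<Rightarrow> ereal \<Rightarrow> bool" where
  "nonneg_weighted_ricci A g \<psi> N \<longleftrightarrow>
     (\<forall>\<kappa>\<in>A. \<forall>y\<in>snd \<kappa> ` fst \<kappa>. \<forall>v. weighted_ricci N (g \<kappa>) (\<psi> \<circ> chart_inv \<kappa>) y v \<ge> 0)"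


section \<open>Metric notions\<close>

definition minimal_geodesic :: "(real \<Rightarrow> 'a::metric_space) \<Rightarrow> bool" where
  "minimal_geodesic \<eta> \<longleftrightarrow>
     (\<forall>s\<in>{0..1}. \<forall>t\<in>{0..1}. dist (\<eta> s) (\<eta> t) = \<bar>s - t\<bar> * dist (\<eta> 0) (\<eta> 1))"

text \<open>For functions with values in \<open>\<real> \<union> {- \<infinity>}\<close>.\<close>

definition geodesically_concave :: "('a::metric_space \<Rightarrow> ereal) \<Rightarrow> bool" where
  "geodesically_concave f \<longleftrightarrow>
     (\<forall>\<eta>. minimal_geodesic \<eta> \<longrightarrow> (\<forall>t\<in>{0..1}.
        f (\<eta> t) \<ge> ereal (1 - t) * f (\<eta> 0) + ereal t * f (\<eta> 1)))"

definition powr_on_positive :: "real \<Rightarrow> ('a \<Rightarrow> real) \<Rightarrow> 'a \<Rightarrow> ereal" where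
  "powr_on_positive p \<rho> x = (if \<rho> x > 0 then ereal (\<rho> x powr p) else - \<infinity>)"

definition ln_on_positive :: "('a \<Rightarrow> real) \<Rightarrow> 'a \<Rightarrow> ereal" where
  "ln_on_positive \<rho> x = (if \<rho> x > 0 then ereal (ln (\<rho> x)) else - \<infinity>)"

definition straight_line :: "(real \<Rightarrow> 'a::metric_space) \<Rightarrow> bool" where
  "straight_line \<gamma> \<longleftrightarrow> (\<forall>s t. dist (\<gamma> s) (\<gamma> t) = \<bar>s - t\<bar>)"

definition busemann :: "(real \<Rightarrow> 'a::metric_space) \<Rightarrow> 'a \<Rightarrow> real" where
  "busemann \<gamma> x = Lim at_top (\<lambda>t. t - dist x (\<gamma> t))"

definition in_P2 :: "'a::metric_space measure \<Rightarrow> bool" where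
  "in_P2 \<mu> \<longleftrightarrow> sets \<mu> = sets borel \<and> prob_space \<mu> \<and> (\<exists>z. integrable \<mu> (\<lambda>x. (dist z x)\<^sup>2))"

definition is_barycenter :: "'a::metric_space measure \<Rightarrow> 'a \<Rightarrow> bool" where
  "is_barycenter \<mu> x0 \<longleftrightarrow>
     (\<forall>z. (\<integral>x. (dist x0 x)\<^sup>2 \<partial>\<mu>) \<le> (\<integral>x. (dist z x)\<^sup>2 \<partial>\<mu>))"

definition measure_supp :: "'a::topological_space measure \<Rightarrow> 'a set" where
  "measure_supp \<mu> = {x. \<forall>U. open U \<and> x \<in> U \<longrightarrow> emeasure \<mu> U > 0}"


section \<open>Localization\<close>

text \<open>For a nonnegative density on the line.  The conventions are \<open>log 0 = - \<infinity>\<close> and, since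
  \<open>convex_powr\<close> is only used with \<open>p < 0\<close>, \<open>0 powr p = \<infinity>\<close>; hence the restriction to
  the positivity set, whose convexity is part of \<open>convex_on\<close>.\<close>

definition convex_powr :: "real \<Rightarrow> (real \<Rightarrow> real) \<Rightarrow> bool" where
  "convex_powr p w \<longleftrightarrow> convex_on {x. w x > 0} (\<lambda>x. w x powr p)"

definition log_concave :: "(real \<Rightarrow> real) \<Rightarrow> bool" where
  "log_concave w \<longleftrightarrow> concave_on {x. w x > 0} (\<lambda>x. ln (w x))"

definition arclength_param :: "'a::metric_space set \<Rightarrow> real set \<Rightarrow> (real \<Rightarrow> 'a) \<Rightarrow> bool" where
  "arclength_param L I \<eta> \<longleftrightarrow>
     is_interval I \<and> I \<noteq> {} \<and> (\<forall>s\<in>I. \<forall>t\<in>I. dist (\<eta> s) (\<eta> t) = \<bar>s - t\<bar>) \<and> L = \<eta> ` I"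

text \<open>\<open>CD(0,N)\<close> for a needle \<open>L\<close>, for \<open>N = \<infinity>\<close> or \<open>N < -1\<close>.\<close>

definition needle_CD0 :: "ereal \<Rightarrow> 'a::metric_space set \<Rightarrow> 'a measure \<Rightarrow> bool" where
  "needle_CD0 N L \<nu> \<longleftrightarrow>
     (\<exists>I \<eta> \<zeta>. arclength_param L I \<eta> \<and>
        \<zeta> \<in> borel_measurable borel \<and> (\<forall>t. \<zeta> t \<ge> 0) \<and> (\<forall>t. t \<notin> I \<longrightarrow> \<zeta> t = 0) \<and>
        \<nu> = distr (density (restrict_space lborel I) (\<lambda>t. ennreal (\<zeta> t))) borel \<eta> \<and>
        (if N = \<infinity> then log_concave \<zeta> else convex_powr (1 / (real_of_ereal N - 1)) \<zeta>))"

definition needle_mu :: "('a \<Rightarrow> real) \<Rightarrow> 'a measure \<Rightarrow> 'a measure" where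
  "needle_mu \<rho> \<nu> = density \<nu> (\<lambda>x. ennreal (\<rho> x))"

text \<open>
  \<open>localization m \<rho> N \<gamma> Z Q L mq w\<close>: the measure space \<open>Q\<close>, the needles \<open>L q\<close>, the
  probability measures \<open>mq q\<close> and the densities \<open>w q\<close> form a localization associated with
  the function \<open>busemann \<gamma> * \<rho>\<close>, with exceptional set \<open>Z\<close>.

  Unions of measurable families of needles are measurable (the projection onto the index space is
  measurable), up to null sets, hence the completion.  The support of an integrable function is
  understood as that of its class modulo null sets.  In general \<open>busemann \<gamma>\<close> is not an
  arclength parameter of a needle, only injective on it, so \<open>w q\<close> is the density of the push-forward
  under \<open>busemann \<gamma>\<close>.  The convexity properties are pointwise and thereby
  determine \<open>w q\<close> in the interior of its interval of positivity.\<close>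

definition localization ::
    "'a::metric_space measure \<Rightarrow> ('a \<Rightarrow> real) \<Rightarrow> ereal \<Rightarrow> (real \<Rightarrow> 'a) \<Rightarrow> 'a set \<Rightarrow> 'q measure \<Rightarrow>
     ('q \<Rightarrow> 'a set) \<Rightarrow> ('q \<Rightarrow> 'a measure) \<Rightarrow> ('q \<Rightarrow> real \<Rightarrow> real) \<Rightarrow> bool" where
  "localization m \<rho> N \<gamma> Z Q L mq w \<longleftrightarrow>
    (let b = busemann \<gamma>; \<mu> = density m (\<lambda>x. ennreal (\<rho> x)); \<Omega> = measure_supp \<mu>;
         pos = (\<lambda>q. measure (needle_mu \<rho> (mq q)) (L q) > 0) in
     (AE x in m. x \<in> Z \<longrightarrow> b x * \<rho> x = 0) \<and>
     (AE x in \<mu>. x \<notin> Z) \<and>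
     (\<Union>q\<in>space Q. L q) = - Z \<and> disjoint_family_on L (space Q) \<and>
     (\<forall>S\<in>sets Q. (\<Union>q\<in>S. L q) \<in> sets (completion m)) \<and>
     (\<forall>q\<in>space Q. (\<exists>I \<eta>. arclength_param (L q) I \<eta>) \<and>
        prob_space (mq q) \<and> sets (mq q) = sets borel \<and> emeasure (mq q) (L q) = 1) \<and>
     (\<forall>\<phi> :: 'a \<Rightarrow> real. integrable m \<phi> \<and> (AE x in m. x \<notin> \<Omega> \<longrightarrow> \<phi> x = 0) \<longrightarrow>
        (AE q in Q. integrable (mq q) \<phi>) \<and>
        integrable Q (\<lambda>q. LINT x:L q|mq q. \<phi> x) \<and>
        (LINT x:\<Omega>|m. \<phi> x) = (LINT q|Q. (LINT x:L q|mq q. \<phi> x))) \<and>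
     (AE q in Q. (LINT x:L q|mq q. b x * \<rho> x) = 0 \<and> needle_CD0 N (L q) (mq q)) \<and>
     (AE q in Q. pos q \<longrightarrow>
        inj_on b (L q) \<and>
        w q \<in> borel_measurable borel \<and> (\<forall>x. w q x \<ge> 0) \<and> (\<forall>x. x \<notin> b ` L q \<longrightarrow> w q x = 0) \<and>
        distr (needle_mu \<rho> (mq q)) borel b = density lborel (\<lambda>x. ennreal (w q x))) \<and>
     (\<forall>\<beta>. - \<infinity> < N \<and> N < ereal \<beta> \<and> \<beta> < -1 \<and>
        geodesically_concave (powr_on_positive (1 / (\<beta> - real_of_ereal N)) \<rho>) \<longrightarrow>
        (AE q in Q. pos q \<longrightarrow> convex_powr (1 / (\<beta> - 1)) (w q))) \<and>
     (N = \<infinity> \<and> geodesically_concave (ln_on_positive \<rho>) \<longrightarrow>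
        (AE q in Q. pos q \<longrightarrow> log_concave (w q))))"


section \<open>Quantities in the stability estimates\<close>

definition needle_c :: "(real \<Rightarrow> real) \<Rightarrow> real" where
  "needle_c w = w 0 / (LINT x:{..0}|lborel. w x)"

text \<open>The distribution function of the normalization of \<open>\<mu>q\<close>, a measure concentrated on the needle
  \<open>L\<close>, transported to the line by \<open>b\<close>.\<close>

definition needle_cdf :: "('a::metric_space \<Rightarrow> real) \<Rightarrow> 'a set \<Rightarrow> 'a measure \<Rightarrow> real \<Rightarrow> real" where
  "needle_cdf b L \<mu>q = cdf (distr (scale_measure (ennreal (1 / measure \<mu>q L)) \<mu>q) borel b)"

definition model_cdf_power :: "real \<Rightarrow> real \<Rightarrow> real \<Rightarrow> real" where
  "model_cdf_power \<beta> c = cdf (density lborel (\<lambda>x. ennreal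
     (if x \<le> 1 / c then c * (\<beta> / (\<beta> + 1)) powr \<beta> * (1 + c / \<beta> * x) powr (\<beta> - 1) else 0)))"

definition model_cdf_exp :: "real \<Rightarrow> real \<Rightarrow> real" where
  "model_cdf_exp c = cdf (density lborel (\<lambda>x. ennreal
     (if x \<le> 1 / c then c * exp (c * x - 1) else 0)))"

end

theory Submission
  imports Defs "HOL-Real_Asymp.Real_Asymp"
begin

text \<open>
  The needles on which \<open>\<mu>\<^sub>q({b \<le> 0})\<close> exceeds \<open>(1 + \<epsilon>')\<kappa> \<mu>\<^sub>q(M\<^sub>q)\<close>, with \<open>\<kappa>\<close> the Gruenbaum constant,
  carry mass at most \<open>1 / (1 + \<delta>)\<close> by Markov's inequality, because \<open>1 + \<epsilon>' = (1 + \<epsilon>)(1 + \<delta>)\<close>.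
  On any other needle, \<open>R\<^sub>q\<close> and the model \<open>F\<^sub>q\<close> have mean zero, so \<open>R\<^sub>q - F\<^sub>q\<close> has integral zero and it
  suffices to bound its positive part.  The density and the model density, scaled to agree at \<open>0\<close>
  and to have the same mass on the negative half line, cross only once there, whence
  \<open>R\<^sub>q \<le> min ((1 + \<epsilon>') F\<^sub>q) 1\<close>, and the integral of \<open>min ((1 + \<epsilon>') F\<^sub>q) 1 - F\<^sub>q\<close> is explicit.
  In the log-concave case one needs in addition that a centered log-concave probability density \<open>f\<close>
  has variance at least \<open>1 / (12 f(0)\<^sup>2)\<close>.  Since \<open>f\<close> lies below an exponential with the same value
  at \<open>0\<close>, linear programming duality reduces this to truncated exponentials.
\<close>

section \<open>Integrals and distribution functions on the line\<close>

text \<open>On a selected needle the hypothesis bounds \<open>R_q\<close> from above at the single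
  point 0. Convexity spreads this to an upper bound on the whole line, but no lower bound on
  \<open>R_q\<close> is available. Centering replaces it: laws with equal means have distribution
  functions whose difference integrates to 0, so the L1 distance is twice the integral of the
  positive part.

  The model takes the value \<kappa> at 0 for every rate \<open>c\<close>, and its cut at
  \<open>1 / c\<close> makes it centered. With \<open>r = 1 + \<epsilon>'\<close>, the function
  \<open>min (r * F) 1\<close> is, in the exponential case, \<open>F\<close> translated by
  \<open>ln r / c\<close>, so the excess integrates to \<open>ln r / c\<close>; in the power case
  the variable \<open>1 + c / \<beta> * x\<close> is dilated instead, and the excess is
  \<open>\<beta> * (1 - r powr (- 1 / \<beta>)) / c\<close>. The rate is then removed by
  \<open>1 / c = G / w 0 \<le> r * \<kappa> * M / w 0\<close>, with \<open>M\<close> the mass of the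
  needle and \<open>G\<close> its mass on the negative half line. In the log-concave case
  \<open>M / w 0\<close> is at most \<open>sqrt 12\<close> times the standard deviation, which
  yields \<open>4 * sqrt 3 / exp 1\<close>; the 12 is that of the variance of a uniform law.\<close>

lemma set_integral_FTC_atMost:
  fixes f F :: "real \<Rightarrow> real"
  assumes f_borel: "f \<in> borel_measurable borel"
    and f: "\<And>x. x \<le> a \<Longrightarrow> DERIV F x :> f x"
    and nonneg: "\<And>x. x \<le> a \<Longrightarrow> 0 \<le> f x"
    and lim: "(F \<longlongrightarrow> 0) at_bot"
  shows "set_integrable lborel {..a} f" and "(LINT x:{..a}|lborel. f x) = F a"
proof -
  have "(\<integral>\<^sup>+x. ennreal (f x) * indicator {..a} x \<partial>lborel)
      = (\<integral>\<^sup>+x. ennreal (f (- x)) * indicator {- a..} x \<partial>lborel)"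
    using f_borel
    by (subst nn_integral_real_affine[where c = "-1" and t = 0])
      (auto intro!: nn_integral_cong simp: indicator_def)
  also have "\<dots> = ennreal (0 - - F (- (- a)))"
  proof (rule nn_integral_FTC_atLeast)
    show "(\<lambda>x. f (- x)) \<in> borel_measurable borel" using f_borel by measurable
    show "((\<lambda>x. - F (- x)) has_real_derivative f (- x)) (at x)" if "- a \<le> x" for x
    proof -
      have "DERIV F (- x) :> f (- x)" using f[of "- x"] that by simp
      then have "DERIV (\<lambda>x. F (- x)) x :> f (- x) * - 1"
        by (rule DERIV_chain2) (auto intro!: derivative_eq_intros)
      then show ?thesis by (auto intro!: derivative_eq_intros)
    qed
    show "0 \<le> f (- x)" if "- a \<le> x" for x using nonneg[of "- x"] that by simp
    show "((\<lambda>x. - F (- x)) \<longlongrightarrow> 0) at_top"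
      using tendsto_minus[OF filterlim_compose[OF lim filterlim_uminus_at_bot_at_top]] by simp
  qed
  also have "(\<integral>\<^sup>+x. ennreal (f x) * indicator {..a} x \<partial>lborel)
      = (\<integral>\<^sup>+x. ennreal (indicator {..a} x *\<^sub>R f x) \<partial>lborel)"
    by (auto intro!: nn_integral_cong simp: indicator_def)
  finally have nn: "(\<integral>\<^sup>+x. ennreal (indicator {..a} x *\<^sub>R f x) \<partial>lborel) = ennreal (F a)"
    by simp
  have mono: "F x \<le> F y" if "x \<le> y" "y \<le> a" for x y
  proof (rule DERIV_nonneg_imp_nondecreasing[OF that(1)])
    fix z assume "x \<le> z" "z \<le> y"
    then have "z \<le> a" using that by simp
    then show "\<exists>d. DERIV F z :> d \<and> 0 \<le> d" using f nonneg by blast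
  qed
  \<comment> \<open>\<open>ennreal\<close> sends negative numbers to 0, so the value
    \<open>F a\<close> can be read off only once it is known to be nonnegative: \<open>F\<close>
    increases from its limit 0.\<close>
  have "0 \<le> F a"
    by (rule tendsto_upperbound[OF lim])
      (auto simp: eventually_at_bot_linorder intro!: mono)
  moreover have "AE x in lborel. 0 \<le> indicator {..a} x *\<^sub>R f x"
    using nonneg by (auto simp: indicator_def)
  moreover have "(\<lambda>x. indicator {..a} x *\<^sub>R f x) \<in> borel_measurable lborel"
    using f_borel by measurable
  ultimately have "has_bochner_integral lborel (\<lambda>x. indicator {..a} x *\<^sub>R f x) (F a)"
    using nn by (intro has_bochner_integral_nn_integral) auto
  then show "set_integrable lborel {..a} f" "(LINT x:{..a}|lborel. f x) = F a"
    by (auto simp: set_integrable_def set_lebesgue_integral_def has_bochner_integral_iff)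
qed

lemma integral_atMost_split:
  fixes f :: "real \<Rightarrow> real"
  assumes "set_integrable lborel {..b} f" "a \<le> b"
  shows "(LINT x:{..b}|lborel. f x) = (LINT x:{..a}|lborel. f x) + (LINT x:{a<..b}|lborel. f x)"
proof -
  have *: "{..b} = {..a} \<union> {a<..b}" using assms by auto
  show ?thesis unfolding *
    by (rule set_integral_Un) (auto intro!: set_integrable_subset[OF assms(1)] simp: assms)
qed

lemma set_integral_lessThan_eq_atMost:
  fixes f :: "real \<Rightarrow> real"
  assumes "set_integrable lborel {..a} f"
  shows "(LINT x:{..<a}|lborel. f x) = (LINT x:{..a}|lborel. f x)"
  unfolding set_lebesgue_integral_def
proof (rule integral_cong_AE)
  have "set_integrable lborel {..<a} f" by (rule set_integrable_subset[OF assms]) auto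
  then show "(\<lambda>x. indicator {..<a} x *\<^sub>R f x) \<in> borel_measurable lborel"
    unfolding set_integrable_def by (rule borel_measurable_integrable)
  show "(\<lambda>x. indicator {..a} x *\<^sub>R f x) \<in> borel_measurable lborel"
    using assms unfolding set_integrable_def by (rule borel_measurable_integrable)
  show "AE x in lborel. indicator {..<a} x *\<^sub>R f x = indicator {..a} x *\<^sub>R f x"
    using AE_lborel_singleton[of a] by eventually_elim (auto simp: indicator_def)
qed

lemma positive_on_imp_integral_pos:
  fixes f :: "real \<Rightarrow> real"
  assumes "set_integrable lborel {..<a} f" "\<And>x. x < a \<Longrightarrow> 0 < f x"
  shows "0 < (LINT x:{..<a}|lborel. f x)"
proof -
  have *: "(LINT x:{..<a}|lborel. f x) = integral\<^sup>L lborel (\<lambda>x. indicator {..<a} x *\<^sub>R f x)"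
    by (simp add: set_lebesgue_integral_def)
  have nn: "AE x in lborel. 0 \<le> indicator {..<a} x *\<^sub>R f x"
    using assms(2) by (auto simp: indicator_def less_imp_le)
  show ?thesis
  proof (rule ccontr)
    assume "\<not> ?thesis"
    with integral_nonneg_AE[OF nn] have "integral\<^sup>L lborel (\<lambda>x. indicator {..<a} x *\<^sub>R f x) = 0"
      unfolding * by linarith
    then have "AE x in lborel. indicator {..<a} x *\<^sub>R f x = 0"
      using integral_nonneg_eq_0_iff_AE[OF _ nn] assms(1) by (auto simp: set_integrable_def)
    then have "AE x in lborel. x \<notin> {..<a}"
      by eventually_elim (use assms(2) in \<open>force simp: indicator_def\<close>)
    then have "emeasure lborel {..<a} = 0"
      by (subst (asm) AE_iff_measurable[of "{..<a}"]) auto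
    moreover have "emeasure lborel {a - 1..<a} \<le> emeasure lborel {..<a}"
      by (rule emeasure_mono) auto
    ultimately show False by simp
  qed
qed

text \<open>The two relevant choices of \<open>T\<close> are \<open>v powr p\<close> with \<open>p < 0\<close> and \<open>- ln v\<close>; they make the model
  densities \<open>h\<close> affine.\<close>

lemma cdf_le_single_crossing:
  fixes w h T :: "real \<Rightarrow> real"
  assumes w: "integrable lborel w" and "0 < w 0"
    and w_nonneg: "\<And>x. 0 \<le> w x"
    and conv: "convex_on {x. w x > 0} (\<lambda>x. T (w x))"
    and T: "\<And>u v. 0 < u \<Longrightarrow> u < v \<Longrightarrow> T v < T u"
    and "0 < e" and h_pos: "\<And>x. x < e \<Longrightarrow> 0 < h x"
    and affine: "\<And>x. x < e \<Longrightarrow> T (h x) = A + B * x"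
    and "h 0 = w 0"
    and h: "\<And>x. x < e \<Longrightarrow> set_integrable lborel {..x} h"
    and eq: "(LINT y:{..0}|lborel. h y) = (LINT y:{..0}|lborel. w y)"
    and "x < e"
  shows "(LINT y:{..x}|lborel. w y) \<le> (LINT y:{..x}|lborel. h y)"
proof -
  have T_le: "v \<le> u" if "T u \<le> T v" "0 < u" for u v
    using T[of u v] that by force
  have T_mono: "T v \<le> T u" if "u \<le> v" "0 < u" for u v
    using T[of u v] that by (cases "u = v") auto
  have wi: "set_integrable lborel S w" if "S \<in> sets borel" for S
    using w that by (auto simp: set_integrable_def simp del: real_scaleR_def intro: integrable_mult_indicator)
  have T0: "T (w 0) = A" using affine[of 0] \<open>h 0 = w 0\<close> \<open>0 < e\<close> by simp
  \<comment> \<open>\<open>T \<circ> h\<close> is affine, \<open>T \<circ> w\<close> is convex, and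
    they agree at 0. If \<open>T \<circ> w\<close> lies below at \<open>z\<close>, it lies below on
    all of \<open>{z..0}\<close>; since \<open>T\<close> is decreasing, \<open>w\<close> then
    dominates \<open>h\<close> there. So there is at most one crossing on the negative side.\<close>
  have above: "h y \<le> w y" if "h z \<le> w z" "z \<le> y" "y \<le> 0" "z < 0" for y z
  proof -
    have z: "0 < w z" "T (w z) \<le> A + B * z"
      using h_pos[of z] that T_mono[of "h z" "w z"] affine[of z] \<open>0 < e\<close> by auto
    define t where "t = y / z"
    have t: "0 \<le> t" "t \<le> 1" "y = t * z"
      using that by (auto simp: t_def divide_nonpos_neg field_simps)
    have mem: "y \<in> {x. w x > 0}"
      using convexD[OF convex_on_imp_convex[OF conv], of 0 z "1 - t" t] \<open>0 < w 0\<close> z t by auto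
    have "T (w y) \<le> (1 - t) * T (w 0) + t * T (w z)"
      using convex_onD[OF conv, of t 0 z] \<open>0 < w 0\<close> z t by auto
    also have "\<dots> \<le> (1 - t) * A + t * (A + B * z)"
      using z t by (auto simp: T0 intro: mult_left_mono)
    also have "\<dots> = A + B * y" by (simp add: t algebra_simps)
    also have "\<dots> = T (h y)" using affine[of y] that \<open>0 < e\<close> by simp
    finally show ?thesis using T_le mem by auto
  qed
  show ?thesis
  proof (cases "x < 0")
    case True
    \<comment> \<open>To the right of the crossing, \<open>w\<close> exceeds \<open>h\<close> on
      \<open>{x<..0}\<close>, and equal masses on \<open>{..0}\<close> leave less for
      \<open>w\<close> on \<open>{..x}\<close>. To the left of it, \<open>w\<close> is below
      \<open>h\<close> on all of \<open>{..x}\<close>.\<close>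
    show ?thesis
    proof (cases "h x \<le> w x")
      case True
      have "(LINT y:{x<..0}|lborel. h y) \<le> (LINT y:{x<..0}|lborel. w y)"
        using above[OF True] \<open>x < 0\<close> \<open>0 < e\<close>
        by (intro set_integral_mono set_integrable_subset[OF h[of 0]] wi) auto
      moreover have "(LINT y:{..0}|lborel. h y) = (LINT y:{..x}|lborel. h y) + (LINT y:{x<..0}|lborel. h y)"
        using h[of 0] \<open>0 < e\<close> \<open>x < 0\<close> by (intro integral_atMost_split) auto
      moreover have "(LINT y:{..0}|lborel. w y) = (LINT y:{..x}|lborel. w y) + (LINT y:{x<..0}|lborel. w y)"
        using wi \<open>x < 0\<close> by (intro integral_atMost_split) auto
      ultimately show ?thesis using eq by linarith
    next
      case False
      have "w y \<le> h y" if "y \<le> x" for y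
        using above[of y x] that False \<open>x < 0\<close> by force
      then show ?thesis using h[OF \<open>x < e\<close>] wi by (intro set_integral_mono) auto
    qed
  next
    case False
    \<comment> \<open>An excess of \<open>w\<close> at some \<open>z > 0\<close> would force
      \<open>w < h\<close> on the entire negative half line: otherwise the chord of
      \<open>T \<circ> w\<close> from a point \<open>y < 0\<close> to \<open>z\<close> would pass
      strictly below \<open>A = T (w 0)\<close> at 0. That contradicts the equal masses on
      \<open>{..0}\<close>.\<close>
    have le: "w z \<le> h z" if "0 < z" "z < e" for z
    proof (rule ccontr)
      assume "\<not> ?thesis"
      then have z: "0 < w z" "h z < w z" "T (w z) < A + B * z"
        using h_pos[of z] that T[of "h z" "w z"] affine[of z] by auto
      have less: "w y < h y" if "y < 0" for y
      proof (rule ccontr)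
        assume "\<not> ?thesis"
        then have y: "0 < w y" "T (w y) \<le> A + B * y"
          using h_pos[of y] that T_mono[of "h y" "w y"] affine[of y] \<open>0 < e\<close> by auto
        define t where "t = - y / (z - y)"
        have t: "0 < t" "t \<le> 1" "(1 - t) * y + t * z = 0"
          using that \<open>0 < z\<close> by (auto simp: t_def field_simps divide_simps)
        have "A \<le> (1 - t) * T (w y) + t * T (w z)"
          using convex_onD[OF conv, of t y z] y z t by (auto simp: T0)
        also have "\<dots> < (1 - t) * (A + B * y) + t * (A + B * z)"
          using y z t by (intro add_le_less_mono mult_left_mono mult_strict_left_mono) auto
        also have "\<dots> = A + B * ((1 - t) * y + t * z)" by algebra
        finally show False using t by simp
      qed
      have "0 < (LINT y:{..<0}|lborel. h y - w y)"
        using less \<open>0 < e\<close>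
        by (intro positive_on_imp_integral_pos set_integral_diff set_integrable_subset[OF h[of 0]] wi) auto
      also have "\<dots> = (LINT y:{..<0}|lborel. h y) - (LINT y:{..<0}|lborel. w y)"
        using \<open>0 < e\<close> by (intro set_integral_diff set_integrable_subset[OF h[of 0]] wi) auto
      also have "(LINT y:{..<0}|lborel. h y) = (LINT y:{..0}|lborel. h y)"
        using h[of 0] \<open>0 < e\<close> by (intro set_integral_lessThan_eq_atMost) auto
      also have "(LINT y:{..<0}|lborel. w y) = (LINT y:{..0}|lborel. w y)"
        using wi by (intro set_integral_lessThan_eq_atMost) auto
      finally show False using eq by simp
    qed
    have "(LINT y:{0<..x}|lborel. w y) \<le> (LINT y:{0<..x}|lborel. h y)"
      using le \<open>x < e\<close> by (intro set_integral_mono set_integrable_subset[OF h[of x]] wi) auto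
    moreover have "(LINT y:{..x}|lborel. h y) = (LINT y:{..0}|lborel. h y) + (LINT y:{0<..x}|lborel. h y)"
      using h[of x] \<open>x < e\<close> False by (intro integral_atMost_split) auto
    moreover have "(LINT y:{..x}|lborel. w y) = (LINT y:{..0}|lborel. w y) + (LINT y:{0<..x}|lborel. w y)"
      using wi False by (intro integral_atMost_split) auto
    ultimately show ?thesis using eq by linarith
  qed
qed

text \<open>For a distribution function, the integral of the unit step minus it is the mean of its
  law, so this computes the mean of a law cut off at \<open>a\<close>. The step is subtracted
  because a distribution function alone is not integrable over the line.\<close>

lemma has_integral_unit_step_minus_truncation:
  fixes u :: "real \<Rightarrow> real"
  assumes u: "set_integrable lborel {..a} u"
  shows "has_bochner_integral lborel (\<lambda>x. indicator {0..} x - (if x \<le> a then u x else 1))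
    (a - (LINT x:{..a}|lborel. u x))"
proof -
  \<comment> \<open>One of the two intervals is empty, according to the sign of \<open>a\<close>;
    the combination is the signed length from 0 to \<open>a\<close>.\<close>
  have step: "has_bochner_integral lborel (\<lambda>x. indicator {0..a} x - indicator {a<..<0} x) a"
  proof -
    have "has_bochner_integral lborel (\<lambda>x. indicator {0..a} x - indicator {a<..<0} x)
        (measure lborel {0..a} - measure lborel {a<..<0})"
      by (intro has_bochner_integral_diff has_bochner_integral_real_indicator emeasure_bounded_finite)
        (auto intro: bounded_subset[OF bounded_closed_interval[of "- \<bar>a\<bar>" "\<bar>a\<bar>"]])
    then show ?thesis by (cases "a \<ge> 0") auto
  qed
  have "has_bochner_integral lborel (\<lambda>x. indicator {..a} x *\<^sub>R u x) (LINT x:{..a}|lborel. u x)"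
    using u by (simp add: set_integrable_def set_lebesgue_integral_def has_bochner_integral_iff)
  from has_bochner_integral_diff[OF step this]
  have "has_bochner_integral lborel
    (\<lambda>x. indicator {0..a} x - indicator {a<..<0} x - indicator {..a} x *\<^sub>R u x)
    (a - (LINT x:{..a}|lborel. u x))" .
  moreover have "(\<lambda>x. indicator {0..a} x - indicator {a<..<0} x - indicator {..a} x *\<^sub>R u x)
     = (\<lambda>x. indicator {0..} x - (if x \<le> a then u x else 1))"
    by (auto simp: indicator_def fun_eq_iff)
  ultimately show ?thesis by simp
qed

text \<open>Fubini for the kernel \<open>?K\<close>: for fixed \<open>y\<close> it integrates in
  \<open>x\<close> to the signed length \<open>y\<close> times \<open>w y\<close>, and in absolute
  value to \<open>\<bar>y * w y\<bar>\<close>, so the finite first moment is exactly what Fubini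
  needs.\<close>

lemma has_integral_unit_step_minus_cdf:
  fixes w :: "real \<Rightarrow> real"
  assumes w: "integrable lborel w" and xw: "integrable lborel (\<lambda>y. y * w y)"
    and w_nonneg: "\<And>x. 0 \<le> w x"
  shows "has_bochner_integral lborel
    (\<lambda>x. indicator {0..} x * (\<integral>y. w y \<partial>lborel) - (LINT y:{..x}|lborel. w y)) (\<integral>y. y * w y \<partial>lborel)"
proof -
  let ?K = "\<lambda>y x. w y * (indicator {0..} x - (if y \<le> x then 1 else 0) :: real)"
  have [measurable]: "w \<in> borel_measurable borel" using w by auto
  have K: "has_bochner_integral lborel (?K y) (w y * y)" for y
  proof -
    have "has_bochner_integral lborel (\<lambda>x. indicator {0..<y} x - indicator {y..<0} x)
        (measure lborel {0..<y} - measure lborel {y..<0})"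
      by (intro has_bochner_integral_diff has_bochner_integral_real_indicator emeasure_bounded_finite)
        (auto intro: bounded_subset[OF bounded_closed_interval[of "- \<bar>y\<bar>" "\<bar>y\<bar>"]])
    moreover have "measure lborel {0..<y} - measure lborel {y..<0} = y"
      by (cases "y \<ge> 0") auto
    ultimately have "has_bochner_integral lborel (\<lambda>x. indicator {0..<y} x - indicator {y..<0} x) y"
      by simp
    moreover have "(\<lambda>x. indicator {0..<y} x - indicator {y..<0} x)
        = (\<lambda>x. indicator {0..} x - (if y \<le> x then 1 else 0 :: real))"
      by (auto simp: indicator_def fun_eq_iff)
    ultimately show ?thesis by (auto intro: has_bochner_integral_mult_right)
  qed
  have Kn: "(\<integral>x. norm (?K y x) \<partial>lborel) = \<bar>y * w y\<bar>" for y
  proof (cases "y \<ge> 0")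
    case True
    then have "(\<lambda>x. norm (?K y x)) = ?K y"
      using w_nonneg[of y] by (auto simp: fun_eq_iff indicator_def)
    then show ?thesis using K[of y] True w_nonneg[of y] by (simp add: has_bochner_integral_iff)
  next
    case False
    then have "(\<lambda>x. norm (?K y x)) = (\<lambda>x. - ?K y x)"
      using w_nonneg[of y] by (auto simp: fun_eq_iff indicator_def)
    then show ?thesis using K[of y] False w_nonneg[of y]
      by (simp add: has_bochner_integral_iff abs_mult)
  qed
  have meas: "case_prod ?K \<in> borel_measurable (lborel \<Otimes>\<^sub>M lborel)" by measurable
  have int: "integrable (lborel \<Otimes>\<^sub>M lborel) (case_prod ?K)"
    using K Kn xw by (intro lborel_pair.Fubini_integrable[OF meas])
      (auto simp: has_bochner_integral_iff simp del: real_norm_def)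
  have inner: "(\<integral>y. ?K y x \<partial>lborel)
      = indicator {0..} x * (\<integral>y. w y \<partial>lborel) - (LINT y:{..x}|lborel. w y)" for x
  proof -
    have "integrable lborel (\<lambda>y. indicator {..x} y *\<^sub>R w y)"
      by (intro integrable_mult_indicator w) auto
    then have "(\<integral>y. indicator {0..} x * w y - indicator {..x} y *\<^sub>R w y \<partial>lborel)
       = indicator {0..} x * (\<integral>y. w y \<partial>lborel) - (LINT y:{..x}|lborel. w y)"
      using w by (simp add: set_lebesgue_integral_def)
    then show ?thesis
      by (rule trans[rotated]) (auto intro!: Bochner_Integration.integral_cong simp: indicator_def)
  qed
  have "(\<integral>x. ?K y x \<partial>lborel) = y * w y" for y
    using has_bochner_integral_integral_eq[OF K] by (simp only: mult.commute)
  then show ?thesis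
    using lborel_pair.integrable_snd[OF int] lborel_pair.Fubini_integral[OF int]
    by (simp only: inner has_bochner_integral_iff prod.case)
qed

text \<open>The absolute value is twice the positive part minus \<open>d\<close>, and
  \<open>k\<close> dominates the positive part.\<close>

lemma nn_integral_abs_le_of_integral_zero:
  fixes d k :: "'a \<Rightarrow> real"
  assumes "has_bochner_integral M d 0" and "has_bochner_integral M k K"
    and "\<And>x. d x \<le> k x" "\<And>x. 0 \<le> k x"
  shows "(\<integral>\<^sup>+x. ennreal \<bar>d x\<bar> \<partial>M) \<le> ennreal (2 * K)"
proof -
  have d: "integrable M d" "integrable M k" and K: "integral\<^sup>L M d = 0" "integral\<^sup>L M k = K"
    using assms by (auto simp: has_bochner_integral_iff)
  have "(\<integral>\<^sup>+x. ennreal \<bar>d x\<bar> \<partial>M) = ennreal (\<integral>x. \<bar>d x\<bar> \<partial>M)"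
    using d by (intro nn_integral_eq_integral) auto
  also have "(\<integral>x. \<bar>d x\<bar> \<partial>M) \<le> (\<integral>x. 2 * k x - d x \<partial>M)"
  proof (rule integral_mono)
    show "\<bar>d x\<bar> \<le> 2 * k x - d x" for x using assms(3)[of x] assms(4)[of x] by linarith
  qed (use d in auto)
  also have "\<dots> = 2 * K" using d K by simp
  finally show ?thesis by (simp add: ennreal_leI)
qed

section \<open>The variance of centered log-concave densities\<close>

lemma sinh_gt_self: "t < sinh t" if "0 < t" for t :: real
proof -
  have "sinh 0 - 0 < sinh t - t"
  proof (rule DERIV_pos_imp_increasing_open[OF that])
    show "\<exists>y. ((\<lambda>x. sinh x - x) has_real_derivative y) (at x) \<and> 0 < y" if "0 < x" "x < t" for x :: real
      using that cosh_real_ge_1[of x] cosh_real_one_iff[of x]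
      by (intro exI[of _ "cosh x - 1"]) (auto intro!: derivative_eq_intros simp del: cosh_real_one_iff)
  qed (auto intro!: continuous_intros)
  then show ?thesis by simp
qed

lemma DERIV_nonneg_imp_nonneg:
  fixes f f' :: "real \<Rightarrow> real"
  assumes "\<And>x. 0 \<le> x \<Longrightarrow> DERIV f x :> f' x" "\<And>x. 0 \<le> x \<Longrightarrow> 0 \<le> f' x" "f 0 = 0" "0 \<le> x"
  shows "0 \<le> f x"
proof -
  have "f 0 \<le> f x"
    using assms by (intro DERIV_nonneg_imp_nondecreasing[OF \<open>0 \<le> x\<close>]) blast
  then show ?thesis using assms(3) by simp
qed

text \<open>Four times the expression is \<open>y * sinh y - 4 * cosh y + 4 + y\<^sup>2\<close> at
  \<open>y = 2 * x\<close>. Differentiating this four times ends at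
  \<open>y * sinh y \<ge> 0\<close>, all intermediate derivatives vanishing at 0. The expression is
  the sign-determining factor of the derivative of \<open>g\<close> in the next proof.\<close>

lemma sinh_cosh_ineq:
  fixes x :: real
  assumes "0 \<le> x"
  shows "0 \<le> x * sinh x * cosh x - 2 * (sinh x)\<^sup>2 + x\<^sup>2"
proof -
  have 1: "0 \<le> y * cosh y - sinh y" if "0 \<le> y" for y :: real
    by (rule DERIV_nonneg_imp_nonneg[where f' = "\<lambda>y. y * sinh y", OF _ _ _ that])
      (auto intro!: derivative_eq_intros)
  have 2: "0 \<le> y * sinh y - 2 * cosh y + 2" if "0 \<le> y" for y :: real
    by (rule DERIV_nonneg_imp_nonneg[where f' = "\<lambda>y. y * cosh y - sinh y", OF _ 1 _ that])
      (auto intro!: derivative_eq_intros)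
  have 3: "0 \<le> y * cosh y - 3 * sinh y + 2 * y" if "0 \<le> y" for y :: real
    by (rule DERIV_nonneg_imp_nonneg[where f' = "\<lambda>y. y * sinh y - 2 * cosh y + 2", OF _ 2 _ that])
      (auto intro!: derivative_eq_intros)
  have "0 \<le> y * sinh y - 4 * cosh y + 4 + y\<^sup>2" if "0 \<le> y" for y :: real
    by (rule DERIV_nonneg_imp_nonneg[where f' = "\<lambda>y. y * cosh y - 3 * sinh y + 2 * y", OF _ 3 _ that])
      (auto intro!: derivative_eq_intros)
  from this[of "2 * x"] assms
  have "0 \<le> 2 * x * (2 * sinh x * cosh x) - 4 * ((cosh x)\<^sup>2 + (sinh x)\<^sup>2) + 4 + (2 * x)\<^sup>2"
    by (simp add: sinh_double cosh_double)
  then show ?thesis by (simp add: cosh_square_eq power_mult_distrib)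
qed

text \<open>This is the bound \<open>1 / (12 * c\<^sup>2)\<close> for the variance of a centered
  truncated exponential with rate \<alpha>, value \<open>c\<close> at 0 and rescaled width
  \<open>2 * t\<close>: its variance is
  \<open>(1 - t\<^sup>2 / (sinh t)\<^sup>2) / \<alpha>\<^sup>2\<close>, and
  \<open>\<alpha> / c\<close> is twice the square root of the left-hand side. After taking
  logarithms the two sides differ by \<open>g\<close> up to a constant; \<open>g\<close> is
  increasing and the inequality becomes sharp as \<open>t\<close> tends to 0, the uniform
  limit.\<close>

lemma truncated_exponential_ineq:
  fixes t :: real
  assumes "0 < t"
  shows "(sinh t)\<^sup>2 * exp (2 - 2 * (t * cosh t / sinh t)) \<le> 3 * (1 - t\<^sup>2 / (sinh t)\<^sup>2)"
proof -
  define g where "g = (\<lambda>t::real. ln ((sinh t)\<^sup>2 - t\<^sup>2) - 4 * ln (sinh t) + 2 * (t * cosh t / sinh t))"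
  have pos: "0 < sinh x" "0 < (sinh x)\<^sup>2 - x\<^sup>2" if "0 < x" for x :: real
    using sinh_gt_self[OF that] that by (auto intro: power_strict_mono)
  have deriv: "\<exists>y. (g has_real_derivative y) (at x) \<and> 0 \<le> y" if "0 < x" for x :: real
  proof (intro exI conjI)
    let ?s = "sinh x" and ?c = "cosh x"
    show "(g has_real_derivative (2 * ?s * ?c - 2 * x) / (?s\<^sup>2 - x\<^sup>2) - 4 * (?c / ?s)
        + 2 * ((?c + x * ?s) * ?s - x * ?c * ?c) / ?s\<^sup>2) (at x)"
      unfolding g_def using pos[OF that]
      by (auto intro!: derivative_eq_intros simp: field_simps power2_eq_square)
    have "(2 * ?s * ?c - 2 * x) / (?s\<^sup>2 - x\<^sup>2) - 4 * (?c / ?s)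
        + 2 * ((?c + x * ?s) * ?s - x * ?c * ?c) / ?s\<^sup>2
      = 2 * x * (x * ?s * ?c - 2 * ?s\<^sup>2 + x\<^sup>2) / (?s\<^sup>2 * (?s\<^sup>2 - x\<^sup>2))"
    proof -
      have c2: "?c * ?c = ?s * ?s + 1" using cosh_square_eq[of x] by (simp add: power2_eq_square)
      have e: "(2 * ?s * ?c - 2 * x) * ?s\<^sup>2 - 4 * ?c * ?s * (?s\<^sup>2 - x\<^sup>2)
          + 2 * (?c * ?s + x * ?s * ?s - x * (?c * ?c)) * (?s\<^sup>2 - x\<^sup>2)
        = 2 * x * (x * ?s * ?c - 2 * ?s\<^sup>2 + x\<^sup>2)"
        unfolding c2 power2_eq_square by algebra
      have "(2 * ?s * ?c - 2 * x) / (?s\<^sup>2 - x\<^sup>2) - 4 * (?c / ?s)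
        + 2 * ((?c + x * ?s) * ?s - x * ?c * ?c) / ?s\<^sup>2
        = ((2 * ?s * ?c - 2 * x) * ?s\<^sup>2 - 4 * ?c * ?s * (?s\<^sup>2 - x\<^sup>2)
          + 2 * (?c * ?s + x * ?s * ?s - x * (?c * ?c)) * (?s\<^sup>2 - x\<^sup>2)) / (?s\<^sup>2 * (?s\<^sup>2 - x\<^sup>2))"
      proof -
        have "a / d - 4 * (c / s) + 2 * b / s\<^sup>2 = (a * s\<^sup>2 - 4 * c * s * d + 2 * b * d) / (s\<^sup>2 * d)"
          if "d \<noteq> 0" "s \<noteq> 0" for a b c d s :: real
          using that by (simp add: field_simps power2_eq_square)
        from this[of "?s\<^sup>2 - x\<^sup>2" ?s "2 * ?s * ?c - 2 * x" ?c "(?c + x * ?s) * ?s - x * ?c * ?c"]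
        show ?thesis using pos[OF that] by (simp add: algebra_simps)
      qed
      then show ?thesis unfolding e .
    qed
    also have "\<dots> \<ge> 0"
      using pos[OF that] sinh_gt_self[OF that] sinh_cosh_ineq[of x] that
      by (intro divide_nonneg_nonneg mult_nonneg_nonneg) (auto intro: less_imp_le)
    finally show "0 \<le> (2 * ?s * ?c - 2 * x) / (?s\<^sup>2 - x\<^sup>2) - 4 * (?c / ?s)
        + 2 * ((?c + x * ?s) * ?s - x * ?c * ?c) / ?s\<^sup>2" .
  qed
  \<comment> \<open>Near 0, \<open>(sinh t)\<^sup>2 - t\<^sup>2\<close> behaves like
    \<open>t ^ 4 / 3\<close> and \<open>t * cosh t / sinh t\<close> tends to 1.\<close>
  have "(g \<longlongrightarrow> ln (1 / 3) + 2) (at_right 0)"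
    unfolding g_def by real_asymp
  then have lim: "(g \<longlongrightarrow> 2 - ln 3) (at_right 0)"
    by (simp add: ln_div)
  have mono: "g x \<le> g t" if "0 < x" "x \<le> t" for x
    using that deriv by (intro DERIV_nonneg_imp_nondecreasing[OF that(2)]) auto
  have "2 - ln 3 \<le> g t"
    by (rule tendsto_upperbound[OF lim])
      (auto simp: eventually_at_right_field assms intro!: exI[of _ t] mono)
  then have "exp (2 - 2 * (t * cosh t / sinh t)) \<le> exp (ln 3 + ln ((sinh t)\<^sup>2 - t\<^sup>2) - 4 * ln (sinh t))"
    by (simp add: g_def)
  also have "\<dots> = 3 * ((sinh t)\<^sup>2 - t\<^sup>2) / (sinh t) ^ 4"
    using pos[OF assms] by (simp add: exp_add exp_diff exp_of_nat_mult[of 4, simplified])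
  finally have "(sinh t)\<^sup>2 * exp (2 - 2 * (t * cosh t / sinh t))
      \<le> (sinh t)\<^sup>2 * (3 * ((sinh t)\<^sup>2 - t\<^sup>2) / (sinh t) ^ 4)"
    by (intro mult_left_mono) auto
  also have "\<dots> = 3 * (1 - t\<^sup>2 / (sinh t)\<^sup>2)"
    using pos[OF assms] by (simp add: divide_simps power2_eq_square power4_eq_xxxx)
  finally show ?thesis .
qed

text \<open>The expression is the ratio of the rate to the value at 0 of the centered truncated
  exponential with rescaled width \<open>2 * t\<close>. It runs continuously from 0, the uniform
  limit, to \<open>exp 1\<close>, the exponential cut off on one side only.\<close>

lemma ex_truncation_parameter:
  fixes s :: real
  assumes "0 < s" "s < exp 1"
  obtains t where "0 < t" "2 * exp (1 - t * cosh t / sinh t) * sinh t = s"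
proof -
  define \<phi> where "\<phi> = (\<lambda>t::real. 2 * exp (1 - t * cosh t / sinh t) * sinh t)"
  have 0: "(\<phi> \<longlongrightarrow> 0) (at_right 0)" unfolding \<phi>_def by real_asymp
  have top: "(\<phi> \<longlongrightarrow> exp 1) at_top" unfolding \<phi>_def by real_asymp
  have "eventually (\<lambda>t. \<phi> t < s \<and> 0 < t) (at_right 0)"
    using order_tendstoD(2)[OF 0 assms(1)] eventually_at_right_less by eventually_elim auto
  then obtain t1 where t1: "0 < t1" "\<phi> t1 < s"
    using eventually_happens[of _ "at_right (0::real)"] by (auto simp: trivial_limit_at_right_real)
  have "eventually (\<lambda>t. s < \<phi> t \<and> t1 < t) at_top"
    using order_tendstoD(1)[OF top assms(2)] eventually_gt_at_top by eventually_elim auto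
  then obtain t2 where t2: "t1 < t2" "s < \<phi> t2"
    using eventually_happens[of _ "at_top :: real filter"] by auto
  have "continuous_on {t1..t2} \<phi>"
    unfolding \<phi>_def using t1 by (auto intro!: continuous_intros)
  with IVT'[of \<phi> t1 s t2] t1 t2 obtain t where "t1 \<le> t" "\<phi> t = s" by auto
  with t1 that[of t] show ?thesis by (auto simp: \<phi>_def)
qed

text \<open>Weak duality for minimising the second moment under the constraint \<open>f \<le> g\<close>, the multipliers
  being the coefficients of \<open>(x + a) * (x - b)\<close>.\<close>

lemma second_moment_ge_dual:
  fixes f g :: "real \<Rightarrow> real"
  assumes f: "integrable lborel f" "integrable lborel (\<lambda>x. x * f x)" "integrable lborel (\<lambda>x. x\<^sup>2 * f x)"
    and mass: "(\<integral>x. f x \<partial>lborel) = 1" and mean: "(\<integral>x. x * f x \<partial>lborel) = 0"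
    and nonneg: "\<And>x. 0 \<le> f x" and le: "\<And>x. f x \<le> g x"
    and g: "has_bochner_integral lborel (\<lambda>x. (x + a) * (x - b) * g x * indicator {- a..b} x) I"
    and "- a \<le> b"
  shows "a * b + I \<le> (\<integral>x. x\<^sup>2 * f x \<partial>lborel)"
proof -
  have "I = (\<integral>x. (x + a) * (x - b) * g x * indicator {- a..b} x \<partial>lborel)"
    using g by (simp add: has_bochner_integral_iff)
  also have "\<dots> \<le> (\<integral>x. x\<^sup>2 * f x + (a - b) * (x * f x) - a * b * f x \<partial>lborel)"
  proof (rule integral_mono)
    show "(x + a) * (x - b) * g x * indicator {- a..b} x
        \<le> x\<^sup>2 * f x + (a - b) * (x * f x) - a * b * f x" for x
    proof -
      have *: "x\<^sup>2 * f x + (a - b) * (x * f x) - a * b * f x = (x + a) * (x - b) * f x" by algebra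
      show ?thesis
      \<comment> \<open>The quadratic is nonpositive between its roots, where
        \<open>f x \<le> g x\<close> gives the lower bound, and nonnegative outside, where
        \<open>0 \<le> f x\<close> does.\<close>
      proof (cases "x \<in> {- a..b}")
        case True
        then have "(x + a) * (x - b) \<le> 0" by (auto intro: mult_nonneg_nonpos)
        with True le[of x] show ?thesis unfolding * by (simp add: mult_left_mono_neg)
      next
        case False
        then have "0 \<le> (x + a) * (x - b)"
          using \<open>- a \<le> b\<close> by (cases "x < - a") (auto intro: mult_nonpos_nonpos)
        with False nonneg[of x] show ?thesis unfolding * by simp
      qed
    qed
  qed (use f g in \<open>auto simp: has_bochner_integral_iff\<close>)
  also have "\<dots> = (\<integral>x. x\<^sup>2 * f x \<partial>lborel) - a * b"
    using f by (simp add: mass mean)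
  finally show ?thesis by simp
qed

text \<open>The multipliers are those for which the truncation \<open>c * exp (\<alpha> * x)\<close> on \<open>{- a..b}\<close> is itself a
  centered probability density, \<open>2 * t = \<alpha> * (a + b)\<close> being its rescaled width.\<close>

lemma second_moment_ge_aux:
  fixes f :: "real \<Rightarrow> real"
  assumes f: "integrable lborel f" "integrable lborel (\<lambda>x. x * f x)" "integrable lborel (\<lambda>x. x\<^sup>2 * f x)"
    and mass: "(\<integral>x. f x \<partial>lborel) = 1" and mean: "(\<integral>x. x * f x \<partial>lborel) = 0"
    and nonneg: "\<And>x. 0 \<le> f x" and le: "\<And>x. f x \<le> c * exp (\<alpha> * x)"
    and "0 < \<alpha>" "0 < c" "\<alpha> < exp 1 * c"
  shows "1 / (12 * c\<^sup>2) \<le> (\<integral>x. x\<^sup>2 * f x \<partial>lborel)"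
proof -
  obtain t where "0 < t" and t: "2 * exp (1 - t * cosh t / sinh t) * sinh t = \<alpha> / c"
    using ex_truncation_parameter[of "\<alpha> / c"] assms by (auto simp: field_simps)
  \<comment> \<open>The interval \<open>{- a..b}\<close> has center \<open>h / \<alpha>\<close> and
    half width \<open>t / \<alpha>\<close>. The weight \<open>exp (\<alpha> * x)\<close> shifts the
    mean from the center by \<open>(t * cosh t / sinh t - 1) / \<alpha>\<close>, so this
    \<open>h\<close> makes the mean 0; the equation for \<open>t\<close> then says that the mass is
    1.\<close>
  define h where "h = 1 - t * cosh t / sinh t"
  define a b where "a = (t - h) / \<alpha>" and "b = (t + h) / \<alpha>"
  \<comment> \<open>Repeated integration by parts: for \<open>p = (x + a) * (x - b)\<close>, an
    antiderivative of \<open>p * exp (\<alpha> * x)\<close> is \<open>exp (\<alpha> * x)\<close>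
    times \<open>p / \<alpha> - p' / \<alpha>\<^sup>2 + p'' / \<alpha> ^ 3\<close>. At both
    endpoints the first term vanishes.\<close>
  define G where "G = (\<lambda>x. c * exp (\<alpha> * x) * ((x + a) * (x - b) / \<alpha> - (2 * x + a - b) / \<alpha>\<^sup>2 + 2 / \<alpha> ^ 3))"
  have s: "0 < sinh t" using \<open>0 < t\<close> by simp
  have ab: "- a \<le> b" using \<open>0 < t\<close> \<open>0 < \<alpha>\<close> by (simp add: a_def b_def field_simps)
  have "has_bochner_integral lborel
     (\<lambda>x. (x + a) * (x - b) * (c * exp (\<alpha> * x)) * indicator {- a..b} x) (G b - G (- a))"
  proof (rule has_bochner_integral_FTC_Icc_real[OF ab])
    show "DERIV G x :> (x + a) * (x - b) * (c * exp (\<alpha> * x))" for x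
      unfolding G_def using \<open>0 < \<alpha>\<close>
      by (auto intro!: derivative_eq_intros simp: divide_simps power2_eq_square power3_eq_cube)
         (auto simp: algebra_simps)
  qed (auto intro!: continuous_intros)
  from second_moment_ge_dual[OF f mass mean nonneg le this ab]
  have "a * b + (G b - G (- a)) \<le> (\<integral>x. x\<^sup>2 * f x \<partial>lborel)" .
  moreover have "G b = c * exp h * exp t * (2 - 2 * t) / \<alpha> ^ 3"
  proof -
    have "\<alpha> * b = h + t" "2 * b + a - b = 2 * t / \<alpha>" "b - b = 0"
      using \<open>0 < \<alpha>\<close> by (auto simp: a_def b_def field_simps)
    then have "G b = c * exp (h + t) * ((b + a) * 0 / \<alpha> - 2 * t / \<alpha> / \<alpha>\<^sup>2 + 2 / \<alpha> ^ 3)"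
      by (simp only: G_def)
    also have "\<dots> = c * exp h * exp t * (2 - 2 * t) / \<alpha> ^ 3"
      using \<open>0 < \<alpha>\<close> unfolding exp_add by (simp add: field_simps power2_eq_square power3_eq_cube)
    finally show ?thesis .
  qed
  moreover have "G (- a) = c * exp h * exp (- t) * (2 + 2 * t) / \<alpha> ^ 3"
  proof -
    have "\<alpha> * (- a) = h + - t" "2 * (- a) + a - b = - (2 * t / \<alpha>)" "- a + a = 0"
      using \<open>0 < \<alpha>\<close> unfolding a_def b_def by (simp_all add: divide_simps) (simp_all add: algebra_simps)?
    then have "G (- a) = c * exp (h + - t) * (0 * (- a - b) / \<alpha> - - (2 * t / \<alpha>) / \<alpha>\<^sup>2 + 2 / \<alpha> ^ 3)"
      by (simp only: G_def)
    also have "\<dots> = c * exp h * exp (- t) * (2 + 2 * t) / \<alpha> ^ 3"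
      using \<open>0 < \<alpha>\<close> unfolding exp_add by (simp add: field_simps power2_eq_square power3_eq_cube)
    finally show ?thesis .
  qed
  moreover have "c * exp h * exp t * (2 - 2 * t) / \<alpha> ^ 3 - c * exp h * exp (- t) * (2 + 2 * t) / \<alpha> ^ 3
     = 4 * c * exp h * (sinh t - t * cosh t) / \<alpha> ^ 3"
  proof -
    have "c * exp h * exp t * (2 - 2 * t) - c * exp h * exp (- t) * (2 + 2 * t)
        = 4 * c * exp h * (sinh t - t * cosh t)"
      unfolding sinh_field_def cosh_field_def by (simp add: algebra_simps)
    then show ?thesis by (simp flip: diff_divide_distrib)
  qed
  \<comment> \<open>Here both normalizations enter: \<open>sinh t - t * cosh t = h * sinh t\<close>
    by centering, and \<open>\<alpha> = 2 * c * exp h * sinh t\<close> by unit mass.\<close>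
  moreover have "4 * c * exp h * (sinh t - t * cosh t) / \<alpha> ^ 3 = 2 * h / \<alpha>\<^sup>2"
  proof -
    have \<alpha>: "\<alpha> = 2 * c * exp h * sinh t"
      using t \<open>0 < c\<close> by (simp add: h_def field_simps)
    have "4 * c * exp h * (sinh t - t * cosh t) = 2 * h * (2 * c * exp h * sinh t)"
      using s by (simp add: h_def field_simps)
    also have "\<dots> = 2 * h * \<alpha>" using \<alpha> by simp
    finally have *: "4 * c * exp h * (sinh t - t * cosh t) = 2 * h * \<alpha>" .
    show ?thesis unfolding * using \<open>0 < \<alpha>\<close> by (simp add: power2_eq_square power3_eq_cube)
  qed
  moreover have "a * b + 2 * h / \<alpha>\<^sup>2 = (t\<^sup>2 + 1 - (1 - h)\<^sup>2) / \<alpha>\<^sup>2"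
    using \<open>0 < \<alpha>\<close> by (simp add: a_def b_def field_simps power2_eq_square)
  \<comment> \<open>Since \<open>1 - h = t * cosh t / sinh t\<close>, the dual value is the variance
    of the truncated exponential itself, so nothing is lost in the duality.\<close>
  moreover have "(t\<^sup>2 + 1 - (1 - h)\<^sup>2) / \<alpha>\<^sup>2 = (1 - t\<^sup>2 / (sinh t)\<^sup>2) / \<alpha>\<^sup>2"
  proof -
    have "t\<^sup>2 + 1 - (1 - h)\<^sup>2 = 1 - t\<^sup>2 / (sinh t)\<^sup>2"
      using s by (simp add: h_def power_divide power_mult_distrib cosh_square_eq field_simps)
    then show ?thesis by simp
  qed
  moreover have "1 / (12 * c\<^sup>2) \<le> (1 - t\<^sup>2 / (sinh t)\<^sup>2) / \<alpha>\<^sup>2"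
  proof -
    have "\<alpha>\<^sup>2 = 4 * c\<^sup>2 * ((sinh t)\<^sup>2 * exp (2 - 2 * (t * cosh t / sinh t)))"
    proof -
      have "\<alpha> = c * (2 * exp (1 - t * cosh t / sinh t) * sinh t)"
        using t \<open>0 < c\<close> by (simp add: field_simps)
      moreover have "exp (2 - 2 * (t * cosh t / sinh t)) = (exp (1 - t * cosh t / sinh t))\<^sup>2"
        by (simp flip: exp_double)
      ultimately show ?thesis by (simp add: power_mult_distrib)
    qed
    also have "\<dots> \<le> 4 * c\<^sup>2 * (3 * (1 - t\<^sup>2 / (sinh t)\<^sup>2))"
      by (intro mult_left_mono truncated_exponential_ineq \<open>0 < t\<close>) auto
    finally have "\<alpha>\<^sup>2 \<le> (1 - t\<^sup>2 / (sinh t)\<^sup>2) * (12 * c\<^sup>2)" by (simp add: algebra_simps)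
    then show ?thesis using \<open>0 < \<alpha>\<close> \<open>0 < c\<close> by (simp add: divide_simps mult.commute)
  qed
  ultimately show ?thesis by linarith
qed

text \<open>The function \<open>1 - \<alpha> * x\<close> integrates to 1 against \<open>f\<close>,
  by mass and mean. Replacing it by its positive part and \<open>f\<close> by the exponential can
  only increase the integral, to \<open>exp 1 * c / \<alpha>\<close>. The extremal law is the
  exponential cut off at \<open>1 / \<alpha>\<close>.\<close>

lemma exponential_rate_le:
  fixes f :: "real \<Rightarrow> real"
  assumes f: "integrable lborel f" "integrable lborel (\<lambda>x. x * f x)"
    and mass: "(\<integral>x. f x \<partial>lborel) = 1" and mean: "(\<integral>x. x * f x \<partial>lborel) = 0"
    and nonneg: "\<And>x. 0 \<le> f x" and le: "\<And>x. f x \<le> c * exp (\<alpha> * x)"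
    and "0 < \<alpha>" "0 < c"
  shows "\<alpha> \<le> exp 1 * c"
proof -
  let ?g = "\<lambda>x. c * exp (\<alpha> * x) * (1 - \<alpha> * x)" and ?G = "\<lambda>x. c * exp (\<alpha> * x) * (2 - \<alpha> * x) / \<alpha>"
  have lim: "(?G \<longlongrightarrow> 0) at_bot" using \<open>0 < \<alpha>\<close> by real_asymp
  have DG: "DERIV ?G x :> ?g x" for x
    using \<open>0 < \<alpha>\<close> by (auto intro!: derivative_eq_intros simp: field_simps)
  have nn: "0 \<le> ?g x" if "x \<le> 1 / \<alpha>" for x
    using that \<open>0 < \<alpha>\<close> \<open>0 < c\<close> by (auto simp: field_simps)
  have g: "set_integrable lborel {..1 / \<alpha>} ?g" "(LINT x:{..1 / \<alpha>}|lborel. ?g x) = ?G (1 / \<alpha>)"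
    by (rule set_integral_FTC_atMost[OF _ DG nn lim]; simp)+
  have "1 = (\<integral>x. f x - \<alpha> * (x * f x) \<partial>lborel)" using f by (simp add: mass mean)
  also have "\<dots> \<le> (\<integral>x. indicator {..1 / \<alpha>} x *\<^sub>R ?g x \<partial>lborel)"
  proof (rule integral_mono)
    show "f x - \<alpha> * (x * f x) \<le> indicator {..1 / \<alpha>} x *\<^sub>R ?g x" for x
    proof (cases "x \<le> 1 / \<alpha>")
      case True
      then have "f x * (1 - \<alpha> * x) \<le> c * exp (\<alpha> * x) * (1 - \<alpha> * x)"
        using \<open>0 < \<alpha>\<close> by (intro mult_right_mono le) (auto simp: field_simps)
      with True show ?thesis by (simp add: algebra_simps)
    next
      case False
      then have "f x * (1 - \<alpha> * x) \<le> 0"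
        using \<open>0 < \<alpha>\<close> nonneg[of x] by (intro mult_nonneg_nonpos) (auto simp: field_simps)
      with False show ?thesis by (simp add: algebra_simps)
    qed
  qed (use f g in \<open>auto simp: set_integrable_def\<close>)
  also have "\<dots> = exp 1 * c / \<alpha>"
    using g(2) \<open>0 < \<alpha>\<close> by (simp add: set_lebesgue_integral_def)
  finally show ?thesis using \<open>0 < \<alpha>\<close> by (simp add: field_simps)
qed

text \<open>Positive rates come from truncated exponentials, rate 0 from the uniform density
  \<open>c\<close>, and negative rates from reflection. The uniform density on an interval of length
  \<open>1 / c\<close> has variance exactly \<open>1 / (12 * c\<^sup>2)\<close>.\<close>

lemma second_moment_ge:
  fixes f :: "real \<Rightarrow> real"
  assumes f: "integrable lborel f" "integrable lborel (\<lambda>x. x * f x)" "integrable lborel (\<lambda>x. x\<^sup>2 * f x)"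
    and mass: "(\<integral>x. f x \<partial>lborel) = 1" and mean: "(\<integral>x. x * f x \<partial>lborel) = 0"
    and nonneg: "\<And>x. 0 \<le> f x" and le: "\<And>x. f x \<le> c * exp (\<alpha> * x)"
    and "0 < c"
  shows "1 / (12 * c\<^sup>2) \<le> (\<integral>x. x\<^sup>2 * f x \<partial>lborel)"
proof -
  \<comment> \<open>Stated for arbitrary densities and rates because the case of a negative rate
    applies it to the reflected density.\<close>
  have pos: "1 / (12 * c\<^sup>2) \<le> (\<integral>x. x\<^sup>2 * f x \<partial>lborel)"
    if f: "integrable lborel f" "integrable lborel (\<lambda>x. x * f x)" "integrable lborel (\<lambda>x. x\<^sup>2 * f x)"
    and mass: "(\<integral>x. f x \<partial>lborel) = 1" and mean: "(\<integral>x. x * f x \<partial>lborel) = 0"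
    and nonneg: "\<And>x. 0 \<le> f x" and le: "\<And>x. f x \<le> c * exp (\<alpha> * x)" and "0 < \<alpha>"
    for f :: "real \<Rightarrow> real" and \<alpha>
  proof (rule tendsto_upperbound)
    show "((\<lambda>d. 1 / (12 * d\<^sup>2)) \<longlongrightarrow> 1 / (12 * c\<^sup>2)) (at_right c)"
      using \<open>0 < c\<close> by (auto intro!: tendsto_intros)
    \<comment> \<open>No truncation has the rate \<open>\<alpha> = exp 1 * c\<close> of the full exponential, so \<open>c\<close> is increased slightly.\<close>
    show "\<forall>\<^sub>F d in at_right c. 1 / (12 * d\<^sup>2) \<le> (\<integral>x. x\<^sup>2 * f x \<partial>lborel)"
      using eventually_at_right_less[of c]
    proof eventually_elim
      case (elim d)
      show ?case
      proof (rule second_moment_ge_aux[OF f mass mean nonneg _ \<open>0 < \<alpha>\<close>])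
        show "f x \<le> d * exp (\<alpha> * x)" for x
          using elim by (intro order_trans[OF le[of x] mult_right_mono]) auto
        show "0 < d" using elim \<open>0 < c\<close> by simp
        have "\<alpha> \<le> exp 1 * c"
          by (rule exponential_rate_le[OF f(1,2) mass mean nonneg le \<open>0 < \<alpha>\<close> \<open>0 < c\<close>])
        also have "\<dots> < exp 1 * d" using elim by simp
        finally show "\<alpha> < exp 1 * d" .
      qed
    qed
  qed simp
  consider "0 < \<alpha>" | "\<alpha> = 0" | "\<alpha> < 0" by linarith
  then show ?thesis
  proof cases
    case 1
    then show ?thesis by (rule pos[OF f mass mean nonneg le])
  next
    case 2
    \<comment> \<open>The uniform density \<open>c\<close> on \<open>{- a..a}\<close> has mass 1 for
      this \<open>a\<close>; the dual multipliers are those with roots at its endpoints.\<close>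
    define a where "a = 1 / (2 * c)"
    define G where "G = (\<lambda>x. c * (x ^ 3 / 3 - a\<^sup>2 * x))"
    have a: "- a \<le> a" using \<open>0 < c\<close> by (simp add: a_def)
    have "has_bochner_integral lborel (\<lambda>x. (x + a) * (x - a) * c * indicator {- a..a} x) (G a - G (- a))"
    proof (rule has_bochner_integral_FTC_Icc_real[OF a])
      show "DERIV G x :> (x + a) * (x - a) * c" for x
        unfolding G_def by (auto intro!: derivative_eq_intros simp: algebra_simps power2_eq_square)
    qed (auto intro!: continuous_intros)
    from second_moment_ge_dual[OF f mass mean nonneg _ this a] le 2
    have "a * a + (G a - G (- a)) \<le> (\<integral>x. x\<^sup>2 * f x \<partial>lborel)" by simp
    moreover have "a * a + (G a - G (- a)) = 1 / (12 * c\<^sup>2)"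
      using \<open>0 < c\<close> by (simp add: G_def a_def field_simps power2_eq_square power3_eq_cube)
    ultimately show ?thesis by simp
  next
    case 3
    have refl: "integrable lborel (\<lambda>x. h (- x))" "(\<integral>x. h (- x) \<partial>lborel) = (\<integral>x. h x \<partial>lborel)"
      if "integrable lborel h" for h :: "real \<Rightarrow> real"
      using that lborel_integrable_real_affine[of h "-1" 0] lborel_integral_real_affine[of "-1" h 0]
      by auto
    have "1 / (12 * c\<^sup>2) \<le> (\<integral>x. x\<^sup>2 * f (- x) \<partial>lborel)"
    proof (rule pos[where \<alpha> = "- \<alpha>"])
      show "integrable lborel (\<lambda>x. f (- x))" "(\<integral>x. f (- x) \<partial>lborel) = 1"
        using refl[OF f(1)] mass by auto
      show "integrable lborel (\<lambda>x. x * f (- x))" "(\<integral>x. x * f (- x) \<partial>lborel) = 0"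
        using refl[OF f(2)] mean by auto
      show "integrable lborel (\<lambda>x. x\<^sup>2 * f (- x))" using refl[OF f(3)] by auto
      show "0 \<le> f (- x)" "f (- x) \<le> c * exp (- \<alpha> * x)" for x
        using nonneg[of "- x"] le[of "- x"] by auto
    qed (use 3 in auto)
    also have "\<dots> = (\<integral>x. x\<^sup>2 * f x \<partial>lborel)" using refl(2)[OF f(3)] by simp
    finally show ?thesis .
  qed
qed

section \<open>Consequences of centering for the position of 0\<close>

lemma centered_imp_AE_zero:
  fixes w :: "real \<Rightarrow> real"
  assumes "integrable lborel (\<lambda>x. x * w x)" "(\<integral>x. x * w x \<partial>lborel) = 0"
    and "(AE x in lborel. 0 \<le> x * w x) \<or> (AE x in lborel. x * w x \<le> 0)"
  shows "(\<integral>x. w x \<partial>lborel) = 0"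
proof -
  have "AE x in lborel. x * w x = 0"
    using assms(3)
  proof
    assume "AE x in lborel. 0 \<le> x * w x"
    then show ?thesis using integral_nonneg_eq_0_iff_AE[OF assms(1)] assms(2) by simp
  next
    assume "AE x in lborel. x * w x \<le> 0"
    then show ?thesis
      using integral_nonneg_eq_0_iff_AE[of lborel "\<lambda>x. - (x * w x)"] assms(1,2) by simp
  qed
  then have "AE x in lborel. w x = 0"
    using AE_lborel_singleton[of 0] by eventually_elim auto
  then show ?thesis by (rule integral_eq_zero_AE)
qed

text \<open>If \<open>w\<close> vanished on one side of 0, then \<open>x * w x\<close> would have
  constant sign and integral 0. So \<open>w\<close> is positive somewhere on each side, and
  convexity covers 0. This gives \<open>w 0 > 0\<close>, without which the rate of the model would
  degenerate, and the supporting line of the logarithm at 0.\<close>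

lemma centered_zero_in_interior:
  fixes w :: "real \<Rightarrow> real"
  assumes xw: "integrable lborel (\<lambda>x. x * w x)" "(\<integral>x. x * w x \<partial>lborel) = 0"
    and "(\<integral>x. w x \<partial>lborel) \<noteq> 0" and nonneg: "\<And>x. 0 \<le> w x" and conv: "convex {x. w x > 0}"
  shows "0 \<in> interior {x. w x > 0}"
proof -
  have "\<exists>x<0. w x > 0"
  proof (rule ccontr)
    assume "\<not> ?thesis"
    then have "w x = 0" if "x < 0" for x using nonneg[of x] that by force
    then have "0 \<le> x * w x" for x using nonneg[of x] by (cases "x < 0") auto
    then show False using centered_imp_AE_zero[OF xw] assms(3) by simp
  qed
  moreover have "\<exists>x>0. w x > 0"
  proof (rule ccontr)
    assume "\<not> ?thesis"
    then have "w x = 0" if "x > 0" for x using nonneg[of x] that by force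
    then have "x * w x \<le> 0" for x using nonneg[of x] by (cases "x > 0") (auto simp: mult_nonpos_nonneg)
    then show False using centered_imp_AE_zero[OF xw] assms(3) by simp
  qed
  ultimately obtain u v where uv: "u < 0" "0 < v" "w u > 0" "w v > 0" by auto
  have "{u..v} \<subseteq> {x. w x > 0}"
    using conv uv by (metis (mono_tags, lifting) closed_segment_eq_real_ivl closed_segment_subset less_trans
      less_imp_le mem_Collect_eq)
  then have "{u<..<v} \<subseteq> {x. w x > 0}"
    by (rule subset_trans[rotated]) auto
  then have "{u<..<v} \<subseteq> interior {x. w x > 0}" by (intro interior_maximal) auto
  with uv show ?thesis by auto
qed

lemma centered_mass_atMost_pos:
  fixes w :: "real \<Rightarrow> real"
  assumes w: "integrable lborel w"
    and xw: "integrable lborel (\<lambda>x. x * w x)" "(\<integral>x. x * w x \<partial>lborel) = 0"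
    and "(\<integral>x. w x \<partial>lborel) \<noteq> 0" and nonneg: "\<And>x. 0 \<le> w x"
  shows "0 < (LINT x:{..0}|lborel. w x)"
proof (rule ccontr)
  assume "\<not> ?thesis"
  moreover have "0 \<le> (LINT x:{..0}|lborel. w x)"
    by (simp add: set_lebesgue_integral_def nonneg)
  ultimately have "(\<integral>x. indicator {..0} x * w x \<partial>lborel) = 0"
    by (simp add: set_lebesgue_integral_def)
  then have "AE x in lborel. indicator {..0} x * w x = 0"
    by (subst (asm) integral_nonneg_eq_0_iff_AE)
      (use w nonneg in \<open>auto intro: integrable_real_mult_indicator simp: mult.commute[of "indicator _ _"]\<close>)
  then have "AE x in lborel. 0 \<le> x * w x"
    by eventually_elim (use nonneg in \<open>force simp: indicator_def zero_le_mult_iff split: if_splits\<close>)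
  then show False using centered_imp_AE_zero[OF xw] assms(4) by simp
qed

lemma second_moment_ge_log_concave:
  fixes f :: "real \<Rightarrow> real"
  assumes f: "integrable lborel f" "integrable lborel (\<lambda>x. x * f x)" "integrable lborel (\<lambda>x. x\<^sup>2 * f x)"
    and mass: "(\<integral>x. f x \<partial>lborel) = 1" and mean: "(\<integral>x. x * f x \<partial>lborel) = 0"
    and nonneg: "\<And>x. 0 \<le> f x" and conc: "concave_on {x. f x > 0} (\<lambda>x. ln (f x))"
  shows "1 / (12 * (f 0)\<^sup>2) \<le> (\<integral>x. x\<^sup>2 * f x \<partial>lborel)"
proof -
  have conv: "convex_on {x. f x > 0} (\<lambda>x. - ln (f x))"
    using conc by (simp add: concave_on_def)
  have int: "0 \<in> interior {x. f x > 0}"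
    using centered_zero_in_interior[OF f(2) mean _ nonneg convex_on_imp_convex[OF conv]] mass by simp
  then have pos: "0 < f 0" using interior_subset by fastforce
  \<comment> \<open>The infimum of the difference quotients is the right derivative of
    \<open>- ln \<circ> f\<close> at 0, a subgradient because 0 is interior. The resulting
    supporting line is the exponential majorant of \<open>f\<close>.\<close>
  define \<alpha> where "\<alpha> = - Inf ((\<lambda>t. (- ln (f 0) - - ln (f t)) / (0 - t)) ` ({0<..} \<inter> {x. f x > 0}))"
  have "f x \<le> f 0 * exp (\<alpha> * x)" for x
  proof (cases "f x > 0")
    case True
    then have "ln (f x) \<le> ln (f 0) + \<alpha> * x"
      using convex_le_Inf_differential[OF conv int, of x] by (simp add: \<alpha>_def)
    then have "exp (ln (f x)) \<le> exp (ln (f 0) + \<alpha> * x)" by simp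
    then show ?thesis using True pos by (simp add: exp_add)
  next
    case False
    then show ?thesis using pos by (simp add: order_trans[of _ 0])
  qed
  from second_moment_ge[OF f mass mean nonneg this pos] show ?thesis .
qed

section \<open>One-dimensional stability\<close>

lemma cdf_density_FTC:
  fixes f F :: "real \<Rightarrow> real"
  assumes "f \<in> borel_measurable borel"
    and "\<And>x. x \<le> a \<Longrightarrow> DERIV F x :> f x" "\<And>x. x \<le> a \<Longrightarrow> 0 \<le> f x" "(F \<longlongrightarrow> 0) at_bot"
  shows "cdf (density lborel (\<lambda>x. ennreal (if x \<le> a then f x else 0))) x = F (min x a)"
proof -
  let ?m = "min x a"
  have FTC: "set_integrable lborel {..?m} f" "(LINT x:{..?m}|lborel. f x) = F ?m"
    by (rule set_integral_FTC_atMost[where F = F]; use assms in auto)+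
  have [measurable]: "f \<in> borel_measurable borel" by fact
  have "emeasure (density lborel (\<lambda>x. ennreal (if x \<le> a then f x else 0))) {..x}
      = (\<integral>\<^sup>+y. ennreal (if y \<le> a then f y else 0) * indicator {..x} y \<partial>lborel)"
    by (rule emeasure_density) auto
  also have "\<dots> = (\<integral>\<^sup>+y. ennreal (indicator {..?m} y *\<^sub>R f y) \<partial>lborel)"
    by (intro nn_integral_cong) (auto simp: indicator_def)
  also have "\<dots> = ennreal (F ?m)"
    using FTC assms(3)
    by (subst nn_integral_eq_integral) (auto simp: set_integrable_def set_lebesgue_integral_def indicator_def)
  finally show ?thesis
    using FTC(2) assms(3) 
    by (auto simp: cdf_def measure_def set_lebesgue_integral_def intro!: enn2real_ennreal integral_nonneg_AE
      simp flip: FTC(2) simp: indicator_def)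
qed

text \<open>The model is \<open>u\<close> up to \<open>a\<close> and 1 beyond; that \<open>u\<close>
  integrates to \<open>a\<close> says that its law has mean 0. The majorant is \<open>v\<close> up
  to \<open>b\<close> and 1 beyond, and its integrated excess over the model is the integral of
  \<open>v\<close> minus \<open>b\<close>. Only an upper bound on the needle's distribution function
  is required, since both means vanish.\<close>

lemma nn_integral_abs_cdf_diff_le:
  fixes w u v :: "real \<Rightarrow> real"
  assumes w: "integrable lborel w" "integrable lborel (\<lambda>x. x * w x)"
    and mean: "(\<integral>x. x * w x \<partial>lborel) = 0" and mass: "(\<integral>x. w x \<partial>lborel) = M" "0 < M"
    and nonneg: "\<And>x. 0 \<le> w x"
    and u: "set_integrable lborel {..a} u" "(LINT x:{..a}|lborel. u x) = a" "\<And>x. x \<le> a \<Longrightarrow> u x \<le> 1"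
    and v: "set_integrable lborel {..b} v" "b \<le> a"
    and uv: "\<And>x. x \<le> b \<Longrightarrow> u x \<le> v x"
    and wv: "\<And>x. x \<le> b \<Longrightarrow> (LINT y:{..x}|lborel. w y) / M \<le> v x"
  shows "(\<integral>\<^sup>+x. ennreal \<bar>(LINT y:{..x}|lborel. w y) / M - (if x \<le> a then u x else 1)\<bar> \<partial>lborel)
    \<le> ennreal (2 * ((LINT x:{..b}|lborel. v x) - b))"
proof (rule nn_integral_abs_le_of_integral_zero)
  have R: "has_bochner_integral lborel (\<lambda>x. indicator {0..} x - (LINT y:{..x}|lborel. w y) / M) 0"
    using has_bochner_integral_divide[OF has_integral_unit_step_minus_cdf[OF w nonneg], of M] mass mean
    by (simp add: diff_divide_distrib)
  have F: "has_bochner_integral lborel (\<lambda>x. indicator {0..} x - (if x \<le> a then u x else 1)) 0"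
    using has_integral_unit_step_minus_truncation[OF u(1)] u(2) by simp
  have K: "has_bochner_integral lborel (\<lambda>x. indicator {0..} x - (if x \<le> b then v x else 1))
      (b - (LINT x:{..b}|lborel. v x))"
    by (rule has_integral_unit_step_minus_truncation[OF v(1)])
  show "has_bochner_integral lborel
      (\<lambda>x. (LINT y:{..x}|lborel. w y) / M - (if x \<le> a then u x else 1)) 0"
    using has_bochner_integral_diff[OF F R] by (simp add: algebra_simps)
  show "has_bochner_integral lborel
      (\<lambda>x. (if x \<le> b then v x else 1) - (if x \<le> a then u x else 1)) ((LINT x:{..b}|lborel. v x) - b)"
    using has_bochner_integral_diff[OF F K] by (simp add: algebra_simps)
  have R1: "(LINT y:{..x}|lborel. w y) / M \<le> 1" for x
  proof -
    have "(LINT y:{..x}|lborel. w y) \<le> (\<integral>y. w y \<partial>lborel)"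
      unfolding set_lebesgue_integral_def
      by (intro integral_mono integrable_mult_indicator w) (auto simp: indicator_def nonneg)
    then show ?thesis using mass by simp
  qed
  show "(LINT y:{..x}|lborel. w y) / M - (if x \<le> a then u x else 1)
      \<le> (if x \<le> b then v x else 1) - (if x \<le> a then u x else 1)" for x
    using R1[of x] wv[of x] by simp
  show "0 \<le> (if x \<le> b then v x else 1) - (if x \<le> a then u x else 1)" for x
    using u(3)[of x] uv[of x] \<open>b \<le> a\<close> by simp
qed

section \<open>Closed forms of the model distribution functions\<close>

lemma DERIV_powr_affine:
  fixes c \<beta> p x :: real
  assumes "0 < 1 + c / \<beta> * x"
  shows "DERIV (\<lambda>x. (1 + c / \<beta> * x) powr p) x :> p * (c / \<beta>) * (1 + c / \<beta> * x) powr (p - 1)"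
proof -
  have "DERIV (\<lambda>x. 1 + c / \<beta> * x) x :> c / \<beta>"
    using DERIV_add[OF DERIV_const[of 1] DERIV_cmult_Id[of "c / \<beta>"]] by simp
  from has_real_derivative_powr'[OF this DERIV_const[of p]] assms
  have "DERIV (\<lambda>x. (1 + c / \<beta> * x) powr p) x :> (1 + c / \<beta> * x) powr p * (c / \<beta> * p / (1 + c / \<beta> * x))"
    by simp
  moreover have "(1 + c / \<beta> * x) powr (p - 1) = (1 + c / \<beta> * x) powr p / (1 + c / \<beta> * x)"
    using assms by (simp add: powr_diff)
  ultimately show ?thesis by (simp add: ac_simps)
qed

lemma powr_affine_at_bot:
  fixes c \<beta> p :: real
  assumes "c / \<beta> < 0" "p < 0"
  shows "((\<lambda>x. (1 + c / \<beta> * x) powr p) \<longlongrightarrow> 0) at_bot"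
proof (rule tendsto_neg_powr[OF assms(2)])
  show "filterlim (\<lambda>x. 1 + c / \<beta> * x) at_top at_bot"
    using assms(1) by real_asymp
qed

lemma model_cdf_power_eq:
  assumes "0 < c" "\<beta> < -1"
  shows "model_cdf_power \<beta> c x
    = (if x \<le> 1 / c then (\<beta> / (\<beta> + 1)) powr \<beta> * (1 + c / \<beta> * x) powr \<beta> else 1)"
proof -
  let ?k = "(\<beta> / (\<beta> + 1)) powr \<beta>"
  have pos: "0 < 1 + c / \<beta> * x" if "x \<le> 1 / c" for x
    using that assms by (simp add: field_simps)
  have "model_cdf_power \<beta> c x = ?k * (1 + c / \<beta> * min x (1 / c)) powr \<beta>"
    unfolding model_cdf_power_def
  proof (rule cdf_density_FTC[where F = "\<lambda>x. ?k * (1 + c / \<beta> * x) powr \<beta>"])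
    show "DERIV (\<lambda>x. ?k * (1 + c / \<beta> * x) powr \<beta>) x :> c * ?k * (1 + c / \<beta> * x) powr (\<beta> - 1)"
      if "x \<le> 1 / c" for x
      using DERIV_cmult[OF DERIV_powr_affine[OF pos[OF that], of \<beta>], of ?k] assms by (simp add: field_simps)
    show "((\<lambda>x. ?k * (1 + c / \<beta> * x) powr \<beta>) \<longlongrightarrow> 0) at_bot"
      using tendsto_mult_right_zero[OF powr_affine_at_bot[of c \<beta> \<beta>], of ?k] assms
      by (simp add: divide_pos_neg)
  qed (use assms in auto)
  \<comment> \<open>The Gruenbaum constant \<open>?k\<close> is the reciprocal of
    \<open>(1 + 1 / \<beta>) powr \<beta>\<close>; this normalizes the density cut at
    \<open>1 / c\<close> to total mass 1.\<close>
  moreover have "?k * (1 + c / \<beta> * (1 / c)) powr \<beta> = 1"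
  proof -
    have "1 + c / \<beta> * (1 / c) = inverse (\<beta> / (\<beta> + 1))" using assms by (simp add: field_simps)
    moreover have "0 < \<beta> / (\<beta> + 1)" using assms by (simp add: divide_neg_neg)
    ultimately show ?thesis using assms by (simp add: powr_mult[symmetric])
  qed
  ultimately show ?thesis by (auto simp: min_def)
qed

lemma model_cdf_exp_eq:
  assumes "0 < c"
  shows "model_cdf_exp c x = (if x \<le> 1 / c then exp (c * x - 1) else 1)"
proof -
  have "model_cdf_exp c x = exp (c * min x (1 / c) - 1)"
    unfolding model_cdf_exp_def
  proof (rule cdf_density_FTC[where F = "\<lambda>x. exp (c * x - 1)"])
    show "((\<lambda>x. exp (c * x - 1)) \<longlongrightarrow> 0) at_bot" using assms by real_asymp
  qed (use assms in \<open>auto intro!: derivative_eq_intros\<close>)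
  then show ?thesis using assms by (auto simp: min_def)
qed

text \<open>Crossing gives a bound by \<open>G * (1 + c / \<beta> * x) powr \<beta>\<close>, and
  \<open>le\<close> turns the factor \<open>G / M\<close> into at most \<open>r * \<kappa>\<close>,
  that is, \<open>r\<close> times the model. Cutting this majorant where it reaches 1 leaves an
  explicit excess proportional to \<open>1 / c\<close>.\<close>

lemma power_needle_stability:
  fixes w :: "real \<Rightarrow> real" and \<beta> M r :: real
  defines "\<kappa> \<equiv> (\<beta> / (\<beta> + 1)) powr \<beta>"
  assumes w: "integrable lborel w" "integrable lborel (\<lambda>x. x * w x)"
    and mean: "(\<integral>x. x * w x \<partial>lborel) = 0" and mass: "(\<integral>x. w x \<partial>lborel) = M" "0 < M"
    and nonneg: "\<And>x. 0 \<le> w x"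
    and conv: "convex_powr (1 / (\<beta> - 1)) w" and "\<beta> < -1" and "1 \<le> r"
    and le: "(LINT x:{..0}|lborel. w x) \<le> r * \<kappa> * M"
  shows "(\<integral>\<^sup>+x. ennreal \<bar>(LINT y:{..x}|lborel. w y) / M - model_cdf_power \<beta> (needle_c w) x\<bar> \<partial>lborel)
    \<le> ennreal (2 * \<beta> * \<kappa> * r * (1 - r powr (- 1 / \<beta>)) * (M / w 0))"
proof -
  define G where "G = (LINT x:{..0}|lborel. w x)"
  define c where "c = needle_c w"
  have conv': "convex_on {x. w x > 0} (\<lambda>x. w x powr (1 / (\<beta> - 1)))"
    using conv by (simp add: convex_powr_def)
  have "0 < w 0"
    using interior_subset centered_zero_in_interior[OF w(2) mean _ nonneg convex_on_imp_convex[OF conv']] mass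
    by fastforce
  have "0 < G"
    unfolding G_def using centered_mass_atMost_pos[OF w mean _ nonneg] mass by simp
  have "0 < c" and c: "c = w 0 / G"
    using \<open>0 < w 0\<close> \<open>0 < G\<close> by (auto simp: c_def needle_c_def G_def)
  have "c / \<beta> < 0" using \<open>0 < c\<close> \<open>\<beta> < -1\<close> by (simp add: divide_pos_neg)
  \<comment> \<open>The zero of \<open>1 + c / \<beta> * x\<close>, where \<open>h\<close> below
    blows up. As \<open>\<beta> < -1\<close>, it lies beyond the endpoint \<open>1 / c\<close> of
    the model.\<close>
  define e where "e = - \<beta> / c"
  have "0 < e" using \<open>0 < c\<close> \<open>\<beta> < -1\<close> by (simp add: e_def divide_neg_pos)
  have "1 / c < e" unfolding e_def using \<open>0 < c\<close> \<open>\<beta> < -1\<close> by (intro divide_strict_right_mono) auto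
  have pos: "0 < 1 + c / \<beta> * x" if "x < e" for x
    using that \<open>0 < c\<close> \<open>\<beta> < -1\<close> by (simp add: e_def field_simps)
  have "0 < \<beta> / (\<beta> + 1)" using \<open>\<beta> < -1\<close> by (simp add: divide_neg_neg)
  then have "0 < \<kappa>" using \<open>\<beta> < -1\<close> by (simp add: \<kappa>_def)
  \<comment> \<open>The model density rescaled to the value \<open>w 0\<close> at 0. Its mass on
    \<open>{..0}\<close> is \<open>w 0 / c\<close>, so the definition of \<open>needle_c\<close> is
    exactly the matching of this mass with \<open>G\<close>.\<close>
  define h where "h = (\<lambda>x. w 0 * (1 + c / \<beta> * x) powr (\<beta> - 1))"
  have h: "set_integrable lborel {..x} h" "(LINT y:{..x}|lborel. h y) = G * (1 + c / \<beta> * x) powr \<beta>"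
    if "x < e" for x
  proof -
    have D: "DERIV (\<lambda>x. G * (1 + c / \<beta> * x) powr \<beta>) y :> h y" if "y \<le> x" for y
      using DERIV_cmult[OF DERIV_powr_affine[OF pos, of y \<beta>], of G] \<open>x < e\<close> that \<open>\<beta> < -1\<close> \<open>0 < G\<close>
      by (simp add: h_def c)
    have lim: "((\<lambda>x. G * (1 + c / \<beta> * x) powr \<beta>) \<longlongrightarrow> 0) at_bot"
      using tendsto_mult_right_zero[OF powr_affine_at_bot[of c \<beta> \<beta>], of G] \<open>c / \<beta> < 0\<close> \<open>\<beta> < -1\<close> by simp
    show "set_integrable lborel {..x} h" "(LINT y:{..x}|lborel. h y) = G * (1 + c / \<beta> * x) powr \<beta>"
      by (rule set_integral_FTC_atMost[OF _ D _ lim]; use \<open>0 < w 0\<close> in \<open>auto simp: h_def\<close>)+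
  qed
  have R: "(LINT y:{..x}|lborel. w y) \<le> G * (1 + c / \<beta> * x) powr \<beta>" if "x < e" for x
  proof -
    have "(LINT y:{..x}|lborel. w y) \<le> (LINT y:{..x}|lborel. h y)"
    proof (rule cdf_le_single_crossing[OF w(1) \<open>0 < w 0\<close> nonneg conv' _ \<open>0 < e\<close> _ _ _ h(1) _ that])
      show "v powr (1 / (\<beta> - 1)) < u powr (1 / (\<beta> - 1))" if "0 < u" "u < v" for u v :: real
        using that \<open>\<beta> < -1\<close> by (intro powr_less_mono2_neg) auto
      show "h x powr (1 / (\<beta> - 1)) = w 0 powr (1 / (\<beta> - 1)) + w 0 powr (1 / (\<beta> - 1)) * (c / \<beta>) * x"
        if "x < e" for x
        using pos[OF that] \<open>0 < w 0\<close> \<open>\<beta> < -1\<close> by (simp add: h_def powr_mult powr_powr algebra_simps)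
      show "0 < h x" if "x < e" for x using pos[OF that] \<open>0 < w 0\<close> by (simp add: h_def)
      show "h 0 = w 0" by (simp add: h_def)
      show "(LINT y:{..0}|lborel. h y) = (LINT y:{..0}|lborel. w y)"
        using h(2)[of 0] \<open>0 < e\<close> by (simp add: G_def)
    qed
    with h(2)[OF that] show ?thesis by simp
  qed
  \<comment> \<open>In the variable \<open>y = 1 + c / \<beta> * x\<close>, which decreases in
    \<open>x\<close>, the model \<open>\<kappa> * y powr \<beta>\<close> reaches 1 at
    \<open>y0\<close>, that is at \<open>x = 1 / c\<close>, and \<open>r\<close> times the model
    reaches 1 at \<open>yb\<close>, that is at \<open>x = b\<close>.\<close>
  define y0 where "y0 = (\<beta> + 1) / \<beta>"
  define yb where "yb = r powr (- 1 / \<beta>) * y0"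
  define b where "b = \<beta> / c * (yb - 1)"
  have "0 < y0" using \<open>\<beta> < -1\<close> by (simp add: y0_def divide_neg_neg)
  have \<kappa>: "\<kappa> * y0 powr \<beta> = 1"
    using \<open>0 < \<beta> / (\<beta> + 1)\<close> \<open>0 < y0\<close> \<open>\<beta> < -1\<close> by (simp add: \<kappa>_def y0_def powr_mult[symmetric])
  have "1 \<le> r powr (- 1 / \<beta>)" using \<open>1 \<le> r\<close> \<open>\<beta> < -1\<close> by (intro ge_one_powr_ge_zero) (auto simp: divide_nonpos_neg)
  then have "y0 \<le> yb" "0 < yb" using \<open>0 < y0\<close> \<open>1 \<le> r\<close> by (auto simp: yb_def)
  have yb: "1 + c / \<beta> * b = yb" "1 + c / \<beta> * (1 / c) = y0"
    using \<open>0 < c\<close> \<open>\<beta> < -1\<close> by (auto simp: b_def y0_def field_simps)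
  have "b \<le> 1 / c"
  proof -
    have "\<beta> * (yb - 1) \<le> \<beta> * (y0 - 1)" using \<open>y0 \<le> yb\<close> \<open>\<beta> < -1\<close> by (simp add: mult_left_mono_neg)
    also have "\<dots> = 1" using \<open>\<beta> < -1\<close> by (simp add: y0_def field_simps)
    finally show ?thesis using \<open>0 < c\<close> by (simp add: b_def divide_right_mono)
  qed
  \<comment> \<open>The antiderivative has exponent \<open>\<beta> + 1\<close>, which is negative
    because \<open>\<beta> < -1\<close>; hence it vanishes at minus infinity and the model has a
    finite mean.\<close>
  have U: "set_integrable lborel {..a} (\<lambda>x. s * (1 + c / \<beta> * x) powr \<beta>)"
    "(LINT x:{..a}|lborel. s * (1 + c / \<beta> * x) powr \<beta>)
      = s * (\<beta> / (c * (\<beta> + 1))) * (1 + c / \<beta> * a) powr (\<beta> + 1)" if "a < e" "0 \<le> s" for a s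
  proof -
    let ?U = "\<lambda>x. s * (\<beta> / (c * (\<beta> + 1))) * (1 + c / \<beta> * x) powr (\<beta> + 1)"
    have D: "DERIV ?U y :> s * (1 + c / \<beta> * y) powr \<beta>" if "y \<le> a" for y
    proof (rule DERIV_cong)
      show "DERIV ?U y :> s * (\<beta> / (c * (\<beta> + 1))) * ((\<beta> + 1) * (c / \<beta>) * (1 + c / \<beta> * y) powr (\<beta> + 1 - 1))"
        using \<open>a < e\<close> that by (intro DERIV_cmult DERIV_powr_affine pos) simp
      have "s * (\<beta> / (c * (\<beta> + 1))) * ((\<beta> + 1) * (c / \<beta>) * A) = s * A" for A
      proof -
        have "c \<noteq> 0" "\<beta> \<noteq> 0" "\<beta> + 1 \<noteq> 0" using \<open>0 < c\<close> \<open>\<beta> < -1\<close> by auto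
        then show ?thesis by simp
      qed
      then show "s * (\<beta> / (c * (\<beta> + 1))) * ((\<beta> + 1) * (c / \<beta>) * (1 + c / \<beta> * y) powr (\<beta> + 1 - 1))
          = s * (1 + c / \<beta> * y) powr \<beta>" by simp
    qed
    have lim: "(?U \<longlongrightarrow> 0) at_bot"
      using tendsto_mult_right_zero[OF powr_affine_at_bot[of c \<beta> "\<beta> + 1"], of "s * (\<beta> / (c * (\<beta> + 1)))"]
        \<open>c / \<beta> < 0\<close> \<open>\<beta> < -1\<close> by simp
    show "set_integrable lborel {..a} (\<lambda>x. s * (1 + c / \<beta> * x) powr \<beta>)"
      "(LINT x:{..a}|lborel. s * (1 + c / \<beta> * x) powr \<beta>) = ?U a"
      by (rule set_integral_FTC_atMost[OF _ D _ lim]; use \<open>0 \<le> s\<close> in simp)+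
  qed
  have "(\<integral>\<^sup>+x. ennreal \<bar>(LINT y:{..x}|lborel. w y) / M
        - (if x \<le> 1 / c then \<kappa> * (1 + c / \<beta> * x) powr \<beta> else 1)\<bar> \<partial>lborel)
    \<le> ennreal (2 * ((LINT x:{..b}|lborel. (r * \<kappa>) * (1 + c / \<beta> * x) powr \<beta>) - b))"
  proof (rule nn_integral_abs_cdf_diff_le[OF w mean mass nonneg])
    show "set_integrable lborel {..1 / c} (\<lambda>x. \<kappa> * (1 + c / \<beta> * x) powr \<beta>)"
      by (rule U(1)[OF \<open>1 / c < e\<close> less_imp_le[OF \<open>0 < \<kappa>\<close>]])
    \<comment> \<open>The model law has mean 0.\<close>
    show "(LINT x:{..1 / c}|lborel. \<kappa> * (1 + c / \<beta> * x) powr \<beta>) = 1 / c"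
    proof -
      have "(LINT x:{..1 / c}|lborel. \<kappa> * (1 + c / \<beta> * x) powr \<beta>)
          = \<beta> / (c * (\<beta> + 1)) * (\<kappa> * y0 powr \<beta>) * y0"
        using U(2)[OF \<open>1 / c < e\<close>, of \<kappa>] \<open>0 < \<kappa>\<close> \<open>0 < y0\<close> unfolding yb by (simp add: powr_add)
      also have "\<dots> = 1 / c"
      proof -
        have "c \<noteq> 0" "\<beta> \<noteq> 0" "\<beta> + 1 \<noteq> 0" using \<open>0 < c\<close> \<open>\<beta> < -1\<close> by auto
        then show ?thesis unfolding \<kappa> unfolding y0_def by simp
      qed
      finally show ?thesis .
    qed
    show "\<kappa> * (1 + c / \<beta> * x) powr \<beta> \<le> 1" if "x \<le> 1 / c" for x
    proof -
      have "y0 \<le> 1 + c / \<beta> * x"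
        unfolding yb(2)[symmetric] using that \<open>c / \<beta> < 0\<close> by (simp only: add_le_cancel_left mult_left_mono_neg)
      then have "(1 + c / \<beta> * x) powr \<beta> \<le> y0 powr \<beta>"
        using \<open>0 < y0\<close> \<open>\<beta> < -1\<close> by (intro powr_mono2') auto
      then have "\<kappa> * (1 + c / \<beta> * x) powr \<beta> \<le> \<kappa> * y0 powr \<beta>"
        using \<open>0 < \<kappa>\<close> by simp
      then show ?thesis unfolding \<kappa> .
    qed
    show "set_integrable lborel {..b} (\<lambda>x. (r * \<kappa>) * (1 + c / \<beta> * x) powr \<beta>)"
      using U(1)[of b "r * \<kappa>"] \<open>0 < \<kappa>\<close> \<open>1 \<le> r\<close> \<open>b \<le> 1 / c\<close> \<open>1 / c < e\<close> by simp
    show "\<kappa> * (1 + c / \<beta> * x) powr \<beta> \<le> (r * \<kappa>) * (1 + c / \<beta> * x) powr \<beta>" for x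
      using \<open>0 < \<kappa>\<close> \<open>1 \<le> r\<close> by (intro mult_right_mono) auto
    show "(LINT y:{..x}|lborel. w y) / M \<le> (r * \<kappa>) * (1 + c / \<beta> * x) powr \<beta>" if "x \<le> b" for x
    proof -
      have "(LINT y:{..x}|lborel. w y) \<le> G * (1 + c / \<beta> * x) powr \<beta>"
        using that \<open>b \<le> 1 / c\<close> \<open>1 / c < e\<close> by (intro R) simp
      also have "\<dots> \<le> (r * \<kappa> * M) * (1 + c / \<beta> * x) powr \<beta>"
        using le by (intro mult_right_mono) (auto simp: G_def)
      finally show ?thesis using \<open>0 < M\<close> by (simp add: field_simps)
    qed
  qed fact
  also have "(LINT x:{..b}|lborel. (r * \<kappa>) * (1 + c / \<beta> * x) powr \<beta>) - b
      = \<beta> * (1 - r powr (- 1 / \<beta>)) / c"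
  proof -
    have "(r powr (- 1 / \<beta>)) powr \<beta> = 1 / r"
    proof -
      have "(r powr (- 1 / \<beta>)) powr \<beta> = r powr - 1"
        unfolding powr_powr using \<open>\<beta> < -1\<close> by simp
      then show ?thesis using \<open>1 \<le> r\<close> by (simp add: powr_minus_divide)
    qed
    then have "yb powr \<beta> = y0 powr \<beta> / r"
      using \<open>0 < y0\<close> \<open>1 \<le> r\<close> unfolding yb_def powr_mult by simp
    then have "(r * \<kappa>) * yb powr \<beta> = \<kappa> * y0 powr \<beta>"
      using \<open>1 \<le> r\<close> by simp
    also note \<kappa>
    finally have 1: "(r * \<kappa>) * yb powr \<beta> = 1" .
    have "(LINT x:{..b}|lborel. (r * \<kappa>) * (1 + c / \<beta> * x) powr \<beta>)
        = ((r * \<kappa>) * yb powr \<beta>) * (\<beta> / (c * (\<beta> + 1))) * yb"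
      using U(2)[of b "r * \<kappa>"] \<open>0 < \<kappa>\<close> \<open>1 \<le> r\<close> \<open>b \<le> 1 / c\<close> \<open>1 / c < e\<close> \<open>0 < yb\<close> unfolding yb
      by (simp add: powr_add)
    also have "\<dots> - b = \<beta> * (1 - yb / y0) / c"
      using \<open>\<beta> < -1\<close> \<open>0 < c\<close> unfolding 1 b_def y0_def by (simp add: divide_simps) (simp add: algebra_simps)
    also have "yb / y0 = r powr (- 1 / \<beta>)" using \<open>0 < y0\<close> by (simp add: yb_def)
    finally show ?thesis by simp
  qed
  \<comment> \<open>Both \<beta> and \<open>1 - r powr (- 1 / \<beta>)\<close> are nonpositive, so
    their product is nonnegative and \<open>1 / c = G / w 0\<close> may be replaced by its upper
    bound.\<close>
  also have "2 * (\<beta> * (1 - r powr (- 1 / \<beta>)) / c)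
      \<le> 2 * \<beta> * \<kappa> * r * (1 - r powr (- 1 / \<beta>)) * (M / w 0)"
  proof -
    define X where "X = 2 * (\<beta> * (1 - r powr (- 1 / \<beta>)))"
    have "0 \<le> X"
      using \<open>1 \<le> r powr (- 1 / \<beta>)\<close> \<open>\<beta> < -1\<close> by (simp add: X_def mult_nonpos_nonpos)
    then have "X * (1 / c) \<le> X * (r * \<kappa> * M / w 0)"
      using le \<open>0 < w 0\<close> by (intro mult_left_mono) (auto simp: c G_def divide_right_mono)
    moreover have "2 * \<beta> * \<kappa> * r * (1 - r powr (- 1 / \<beta>)) * (M / w 0) = X * (r * \<kappa> * M / w 0)"
      unfolding X_def by simp
    moreover have "2 * (\<beta> * (1 - r powr (- 1 / \<beta>)) / c) = X * (1 / c)"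
      by (simp add: X_def)
    ultimately show ?thesis by (simp only:)
  qed
  finally show ?thesis
    unfolding c_def[symmetric] model_cdf_power_eq[OF \<open>0 < c\<close> \<open>\<beta> < -1\<close>] \<kappa>_def[symmetric]
    by (simp add: ennreal_leI)
qed

text \<open>The excess is \<open>ln r / c\<close>, with \<open>1 / c = G / w 0\<close> at most
  \<open>r * exp (- 1) * M / w 0\<close>. The remaining ratio \<open>M / w 0\<close> is the
  reciprocal of the normalized density at 0, which the variance inequality bounds.\<close>

lemma log_concave_needle_stability:
  fixes w :: "real \<Rightarrow> real" and M r :: real
  assumes w: "integrable lborel w" "integrable lborel (\<lambda>x. x * w x)" "integrable lborel (\<lambda>x. x\<^sup>2 * w x)"
    and mean: "(\<integral>x. x * w x \<partial>lborel) = 0" and mass: "(\<integral>x. w x \<partial>lborel) = M" "0 < M"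
    and nonneg: "\<And>x. 0 \<le> w x"
    and conc: "log_concave w" and "1 \<le> r"
    and le: "(LINT x:{..0}|lborel. w x) \<le> r * exp (- 1) * M"
  shows "(\<integral>\<^sup>+x. ennreal \<bar>(LINT y:{..x}|lborel. w y) / M - model_cdf_exp (needle_c w) x\<bar> \<partial>lborel)
    \<le> ennreal (4 * sqrt 3 / exp 1 * r * ln r * sqrt (1 / M * (\<integral>x. x\<^sup>2 * w x \<partial>lborel)))"
proof -
  define G where "G = (LINT x:{..0}|lborel. w x)"
  define c where "c = needle_c w"
  have conc': "concave_on {x. w x > 0} (\<lambda>x. ln (w x))"
    using conc by (simp add: log_concave_def)
  then have conv': "convex_on {x. w x > 0} (\<lambda>x. - ln (w x))" by (simp add: concave_on_def)
  have "0 < w 0"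
    using interior_subset centered_zero_in_interior[OF w(2) mean _ nonneg convex_on_imp_convex[OF conv']] mass
    by fastforce
  have "0 < G"
    unfolding G_def using centered_mass_atMost_pos[OF w(1,2) mean _ nonneg] mass by simp
  have "0 < c" and c: "c = w 0 / G"
    using \<open>0 < w 0\<close> \<open>0 < G\<close> by (auto simp: c_def needle_c_def G_def)
  have U: "set_integrable lborel {..x} (\<lambda>x. s * exp (c * x))"
    "(LINT y:{..x}|lborel. s * exp (c * y)) = s / c * exp (c * x)" if "0 \<le> s" for x s
  proof -
    have D: "DERIV (\<lambda>x. s / c * exp (c * x)) y :> s * exp (c * y)" for y
      using \<open>0 < c\<close> by (auto intro!: derivative_eq_intros)
    have "((\<lambda>x. exp (c * x)) \<longlongrightarrow> 0) at_bot" using \<open>0 < c\<close> by real_asymp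
    then have lim: "((\<lambda>x. s / c * exp (c * x)) \<longlongrightarrow> 0) at_bot" by (rule tendsto_mult_right_zero)
    show "set_integrable lborel {..x} (\<lambda>x. s * exp (c * x))"
      "(LINT y:{..x}|lborel. s * exp (c * y)) = s / c * exp (c * x)"
      by (rule set_integral_FTC_atMost[OF _ D _ lim]; use \<open>0 \<le> s\<close> in simp)+
  qed
  have R: "(LINT y:{..x}|lborel. w y) \<le> G * exp (c * x)" for x
  proof -
    have "(LINT y:{..x}|lborel. w y) \<le> (LINT y:{..x}|lborel. w 0 * exp (c * y))"
    \<comment> \<open>The exponential is positive with affine logarithm on the whole line, so any
      bound beyond both 0 and \<open>x\<close> serves as \<open>e\<close>.\<close>
    proof (rule cdf_le_single_crossing[OF w(1) \<open>0 < w 0\<close> nonneg conv', where e = "\<bar>x\<bar> + 1"])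
      show "- ln (w 0 * exp (c * y)) = - ln (w 0) + - c * y" for y
        using \<open>0 < w 0\<close> by (simp add: ln_mult)
      show "(LINT y:{..0}|lborel. w 0 * exp (c * y)) = (LINT y:{..0}|lborel. w y)"
        using U(2)[of "w 0" 0] \<open>0 < w 0\<close> by (simp add: c G_def)
      show "set_integrable lborel {..z} (\<lambda>y. w 0 * exp (c * y))" for z
        using U(1)[of "w 0"] \<open>0 < w 0\<close> by simp
    qed (use \<open>0 < w 0\<close> in auto)
    also have "\<dots> = G * exp (c * x)"
      using U(2)[of "w 0" x] \<open>0 < w 0\<close> by (simp add: c)
    finally show ?thesis .
  qed
  have mw: "M / w 0 \<le> 2 * sqrt 3 * sqrt (1 / M * (\<integral>x. x\<^sup>2 * w x \<partial>lborel))"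
  proof -
    have "1 / (12 * (w 0 / M)\<^sup>2) \<le> (\<integral>x. x\<^sup>2 * (w x / M) \<partial>lborel)"
    proof (rule second_moment_ge_log_concave)
      have "{x. w x / M > 0} = {x. w x > 0}" using \<open>0 < M\<close> by (auto simp: zero_less_divide_iff)
      moreover have "concave_on {x. w x > 0} (\<lambda>x. ln (w x / M))"
      proof -
        have "ln (w x / M) = ln (w x) - ln M" if "0 < w x" for x
          using that \<open>0 < M\<close> by (simp add: ln_div)
        moreover have "convex_on {x. w x > 0} (\<lambda>x. - ln (w x) + ln M)"
          by (intro convex_on_add conv' convex_on_const[THEN iffD2] convex_on_imp_convex[OF conv'])
        ultimately show ?thesis
          using convexD[OF convex_on_imp_convex[OF conv']] by (simp add: concave_on_def convex_on_def)
      qed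
      ultimately show "concave_on {x. w x / M > 0} (\<lambda>x. ln (w x / M))" by simp
    qed (use w mean mass nonneg in auto)
    also have "\<dots> = 1 / M * (\<integral>x. x\<^sup>2 * w x \<partial>lborel)" by simp
    finally have "(M / w 0)\<^sup>2 \<le> 12 * (1 / M * (\<integral>x. x\<^sup>2 * w x \<partial>lborel))"
      using \<open>0 < M\<close> \<open>0 < w 0\<close> by (simp add: field_simps power2_eq_square)
    then have "M / w 0 \<le> sqrt (12 * (1 / M * (\<integral>x. x\<^sup>2 * w x \<partial>lborel)))"
      by (rule real_le_rsqrt)
    also have "\<dots> = 2 * sqrt 3 * sqrt (1 / M * (\<integral>x. x\<^sup>2 * w x \<partial>lborel))"
    proof -
      have "sqrt 12 = 2 * sqrt 3" using real_sqrt_mult[of 4 3] by simp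
      then show ?thesis unfolding real_sqrt_mult[of 12] by simp
    qed
    finally show ?thesis .
  qed
  \<comment> \<open>The point where \<open>r * exp (c * x - 1)\<close> reaches 1.\<close>
  define b where "b = (1 - ln r) / c"
  have "b \<le> 1 / c" using \<open>1 \<le> r\<close> \<open>0 < c\<close> by (simp add: b_def divide_right_mono)
  have eb: "r * exp (- 1) * exp (c * b) = 1"
    using \<open>1 \<le> r\<close> \<open>0 < c\<close> by (simp add: b_def exp_diff exp_minus)
  have "(\<integral>\<^sup>+x. ennreal \<bar>(LINT y:{..x}|lborel. w y) / M
        - (if x \<le> 1 / c then exp (- 1) * exp (c * x) else 1)\<bar> \<partial>lborel)
    \<le> ennreal (2 * ((LINT x:{..b}|lborel. (r * exp (- 1)) * exp (c * x)) - b))"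
  proof (rule nn_integral_abs_cdf_diff_le[OF w(1,2) mean mass nonneg])
    show "set_integrable lborel {..1 / c} (\<lambda>x. exp (- 1) * exp (c * x))" by (rule U) simp
    show "(LINT x:{..1 / c}|lborel. exp (- 1) * exp (c * x)) = 1 / c"
      using U(2)[of "exp (- 1)" "1 / c"] \<open>0 < c\<close> by (simp add: exp_minus)
    show "exp (- 1) * exp (c * x) \<le> 1" if "x \<le> 1 / c" for x
      using that \<open>0 < c\<close> by (simp add: field_simps flip: exp_add)
    show "set_integrable lborel {..b} (\<lambda>x. (r * exp (- 1)) * exp (c * x))"
      using \<open>1 \<le> r\<close> by (intro U) simp
    show "exp (- 1) * exp (c * x) \<le> (r * exp (- 1)) * exp (c * x)" for x
      using \<open>1 \<le> r\<close> by (intro mult_right_mono) auto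
    show "(LINT y:{..x}|lborel. w y) / M \<le> (r * exp (- 1)) * exp (c * x)" for x
    proof -
      note R[of x]
      also have "G * exp (c * x) \<le> (r * exp (- 1) * M) * exp (c * x)"
        using le by (intro mult_right_mono) (auto simp: G_def)
      finally show ?thesis using \<open>0 < M\<close> by (simp add: field_simps)
    qed
  qed fact
  also have "(LINT x:{..b}|lborel. (r * exp (- 1)) * exp (c * x)) - b = ln r / c"
  proof -
    have "(LINT x:{..b}|lborel. (r * exp (- 1)) * exp (c * x)) = (r * exp (- 1) * exp (c * b)) / c"
      using U(2)[of "r * exp (- 1)" b] \<open>1 \<le> r\<close> by simp
    then show ?thesis unfolding eb using \<open>0 < c\<close> by (simp add: b_def field_simps)
  qed
  also have "2 * (ln r / c) \<le> 2 * r / exp 1 * ln r * (M / w 0)"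
  proof -
    have "2 * ln r * (1 / c) \<le> 2 * ln r * (r * exp (- 1) * M / w 0)"
      using le \<open>0 < w 0\<close> \<open>1 \<le> r\<close> by (intro mult_left_mono) (auto simp: c G_def divide_right_mono)
    then show ?thesis by (simp add: exp_minus field_simps)
  qed
  also have "\<dots> \<le> 2 * r / exp 1 * ln r * (2 * sqrt 3 * sqrt (1 / M * (\<integral>x. x\<^sup>2 * w x \<partial>lborel)))"
    using \<open>1 \<le> r\<close> by (intro mult_left_mono mw) auto
  finally have "(\<integral>\<^sup>+x. ennreal \<bar>(LINT y:{..x}|lborel. w y) / M
        - (if x \<le> 1 / c then exp (- 1) * exp (c * x) else 1)\<bar> \<partial>lborel)
    \<le> ennreal (2 * r / exp 1 * ln r * (2 * sqrt 3 * sqrt (1 / M * (\<integral>x. x\<^sup>2 * w x \<partial>lborel))))"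
    by (simp add: ennreal_leI)
  moreover have exp_split: "exp (c * x - 1) = exp (- 1) * exp (c * x)" for x
    by (simp add: mult_exp_exp)
  ultimately show ?thesis
    unfolding c_def[symmetric] model_cdf_exp_eq[OF \<open>0 < c\<close>] exp_split by (simp add: algebra_simps)
qed

section \<open>Busemann functions and needles\<close>

text \<open>\<open>Lim\<close> carries information only if the limit exists. By the triangle
  inequality the expression is nondecreasing in \<open>t\<close> and bounded by
  \<open>dist x (\<gamma> 0)\<close>, so it converges to its supremum.\<close>

lemma busemann_tendsto:
  fixes \<gamma> :: "real \<Rightarrow> 'a::metric_space"
  assumes "straight_line \<gamma>"
  shows "((\<lambda>t. t - dist x (\<gamma> t)) \<longlongrightarrow> busemann \<gamma> x) at_top"
proof -
  let ?f = "\<lambda>t. t - dist x (\<gamma> t)"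
  have \<gamma>: "dist (\<gamma> s) (\<gamma> t) = \<bar>s - t\<bar>" for s t using assms by (simp add: straight_line_def)
  have mono: "?f s \<le> ?f t" if "s \<le> t" for s t
    using dist_triangle[of x "\<gamma> t" "\<gamma> s"] \<gamma>[of s t] that by simp
  have "?f t \<le> dist x (\<gamma> 0)" for t
    using dist_triangle[of "\<gamma> 0" "\<gamma> t" x] \<gamma>[of 0 t] by (simp add: dist_commute)
  then have bdd: "bdd_above (range ?f)" by (rule bdd_aboveI2)
  have "(?f \<longlongrightarrow> (SUP t. ?f t)) at_top"
  proof (rule order_tendstoI)
    fix a assume "a < (SUP t. ?f t)"
    then obtain s where "a < ?f s" using less_cSUP_iff[OF _ bdd] by auto
    then show "\<forall>\<^sub>F t in at_top. a < ?f t"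
      by (auto intro!: eventually_mono[OF eventually_ge_at_top[of s]] dest: mono)
  next
    fix a assume "(SUP t. ?f t) < a"
    then have "?f t < a" for t using cSUP_upper[OF UNIV_I bdd, of t] by simp
    then show "\<forall>\<^sub>F t in at_top. ?f t < a" by simp
  qed
  moreover from this have "busemann \<gamma> x = (SUP t. ?f t)"
    unfolding busemann_def by (intro tendsto_Lim) auto
  ultimately show ?thesis by simp
qed

lemma busemann_lipschitz:
  fixes \<gamma> :: "real \<Rightarrow> 'a::metric_space"
  assumes "straight_line \<gamma>"
  shows "\<bar>busemann \<gamma> x - busemann \<gamma> y\<bar> \<le> dist x y"
proof -
  have "busemann \<gamma> x - busemann \<gamma> y \<le> dist x y" for x y
  proof (rule tendsto_upperbound)
    show "((\<lambda>t. (t - dist x (\<gamma> t)) - (t - dist y (\<gamma> t))) \<longlongrightarrow> busemann \<gamma> x - busemann \<gamma> y) at_top"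
      by (intro tendsto_diff busemann_tendsto assms)
    have "(t - dist x (\<gamma> t)) - (t - dist y (\<gamma> t)) \<le> dist x y" for t
      using dist_triangle[of y "\<gamma> t" x] by (simp add: dist_commute)
    then show "\<forall>\<^sub>F t in at_top. (t - dist x (\<gamma> t)) - (t - dist y (\<gamma> t)) \<le> dist x y"
      by simp
  qed simp
  from this[of x y] this[of y x] show ?thesis by (simp add: dist_commute abs_le_iff)
qed

lemma busemann_measurable:
  fixes \<gamma> :: "real \<Rightarrow> 'a::metric_space"
  assumes "straight_line \<gamma>"
  shows "busemann \<gamma> \<in> borel_measurable borel"
proof (rule borel_measurable_continuous_onI)
  have "1-lipschitz_on UNIV (busemann \<gamma>)"
    by (rule lipschitz_onI) (use busemann_lipschitz[OF assms] in \<open>auto simp: dist_real_def\<close>)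
  then show "continuous_on UNIV (busemann \<gamma>)" by (rule lipschitz_on_continuous_on)
qed

text \<open>A point off the support has a null open neighbourhood, which can be shrunk to a member
  of a countable basis; so the complement is a countable union of null sets.\<close>

lemma measure_supp_null:
  fixes \<mu> :: "'a::second_countable_topology measure"
  assumes "sets \<mu> = sets borel"
  shows "- measure_supp \<mu> \<in> null_sets \<mu>"
proof -
  obtain B :: "'a set set" where B: "countable B" "topological_basis B"
    using ex_countable_basis by blast
  have "- measure_supp \<mu> = \<Union> {U \<in> B. emeasure \<mu> U = 0}"
  proof (intro set_eqI iffI)
    fix x assume "x \<in> - measure_supp \<mu>"
    then obtain V where V: "open V" "x \<in> V" "emeasure \<mu> V = 0"
      by (auto simp: measure_supp_def not_gr_zero)
    then obtain U where U: "U \<in> B" "x \<in> U" "U \<subseteq> V" using topological_basisE[OF B(2)] by metis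
    then have "emeasure \<mu> U = 0"
      using emeasure_mono[of U V \<mu>] V assms by simp
    with U show "x \<in> \<Union> {U \<in> B. emeasure \<mu> U = 0}" by auto
  next
    fix x assume "x \<in> \<Union> {U \<in> B. emeasure \<mu> U = 0}"
    then show "x \<in> - measure_supp \<mu>"
      using topological_basis_open[OF B(2)] by (force simp: measure_supp_def)
  qed
  moreover have "(\<Union>U \<in> {U \<in> B. emeasure \<mu> U = 0}. U) \<in> null_sets \<mu>"
    using B(1) topological_basis_open[OF B(2)] assms
    by (intro null_sets_UN') (auto intro: countable_subset)
  ultimately show ?thesis by simp
qed

lemma measure_density_eq_set_integral:
  assumes "f \<in> borel_measurable M" "\<And>x. 0 \<le> f x" "S \<in> sets M"
  shows "measure (density M (\<lambda>x. ennreal (f x))) S = (LINT x:S|M. f x)"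
proof -
  have "emeasure (density M (\<lambda>x. ennreal (f x))) S = (\<integral>\<^sup>+x. ennreal (indicator S x *\<^sub>R f x) \<partial>M)"
    using assms by (subst emeasure_density) (auto intro!: nn_integral_cong simp: indicator_def)
  then show ?thesis
    using assms by (simp add: measure_def set_lebesgue_integral_def integral_eq_nn_integral)
qed

lemma set_integral_full_measure:
  fixes f :: "'a \<Rightarrow> real"
  assumes "prob_space M" "emeasure M L = 1" "f \<in> borel_measurable M"
  shows "(LINT x:L|M. f x) = (\<integral>x. f x \<partial>M)"
proof -
  have L: "L \<in> sets M" using assms(2) emeasure_notin_sets by fastforce
  then have "AE x in M. x \<in> L"
    using assms by (intro prob_space.AE_in_set_eq_1[THEN iffD2]) (auto simp: measure_def)
  then show ?thesis
    unfolding set_lebesgue_integral_def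
    using L assms(3) by (intro integral_cong_AE) auto
qed

lemma needle_transfer:
  fixes \<rho> b :: "'a::topological_space \<Rightarrow> real" and w \<phi> :: "real \<Rightarrow> real"
  assumes "sets \<nu> = sets borel" "\<rho> \<in> borel_measurable borel" "\<And>x. 0 \<le> \<rho> x"
    and "b \<in> borel_measurable borel" "w \<in> borel_measurable borel" "\<And>x. 0 \<le> w x"
    and eq: "distr (needle_mu \<rho> \<nu>) borel b = density lborel (\<lambda>x. ennreal (w x))"
    and "\<phi> \<in> borel_measurable borel"
  shows "integrable lborel (\<lambda>x. \<phi> x * w x) \<longleftrightarrow> integrable \<nu> (\<lambda>x. \<phi> (b x) * \<rho> x)" (is ?A)
    and "(\<integral>x. \<phi> x * w x \<partial>lborel) = (\<integral>x. \<phi> (b x) * \<rho> x \<partial>\<nu>)" (is ?B)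
proof -
  note [measurable_cong] = assms(1)
  note [measurable] = assms(2,4,5,8)
  have b: "b \<in> measurable (needle_mu \<rho> \<nu>) borel" by (simp add: needle_mu_def)
  have "integrable lborel (\<lambda>x. \<phi> x * w x) \<longleftrightarrow> integrable (density lborel (\<lambda>x. ennreal (w x))) \<phi>"
    using assms(6) by (subst integrable_density) (auto simp: mult.commute)
  also have "\<dots> \<longleftrightarrow> integrable (needle_mu \<rho> \<nu>) (\<lambda>x. \<phi> (b x))"
    unfolding eq[symmetric] by (rule integrable_distr_eq[OF b]) measurable
  also have "\<dots> \<longleftrightarrow> integrable \<nu> (\<lambda>x. \<phi> (b x) * \<rho> x)"
    unfolding needle_mu_def using assms(3) by (subst integrable_density) (auto simp: mult.commute)
  finally show ?A .
  have "(\<integral>x. \<phi> x * w x \<partial>lborel) = (\<integral>x. \<phi> x \<partial>density lborel (\<lambda>x. ennreal (w x)))"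
    using assms(6) by (subst integral_density) (auto simp: mult.commute)
  also have "\<dots> = (\<integral>x. \<phi> (b x) \<partial>needle_mu \<rho> \<nu>)"
    unfolding eq[symmetric] by (rule integral_distr[OF b]) measurable
  also have "\<dots> = (\<integral>x. \<phi> (b x) * \<rho> x \<partial>\<nu>)"
    unfolding needle_mu_def using assms(3) by (subst integral_density) (auto simp: mult.commute)
  finally show ?B .
qed

text \<open>As \<open>L\<close> has full measure for \<nu>, integrals over the needle are integrals
  over the whole space, and \<open>eq\<close> moves these to the line. This turns the balance
  condition of the localization into mean 0 for \<open>w\<close>.\<close>

lemma needle_density_facts:
  fixes \<rho> b :: "'a::metric_space \<Rightarrow> real" and w :: "real \<Rightarrow> real"
  assumes \<nu>: "sets \<nu> = sets borel" "prob_space \<nu>" "emeasure \<nu> L = 1"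
    and \<rho>: "\<rho> \<in> borel_measurable borel" "\<And>x. 0 \<le> \<rho> x" and b: "b \<in> borel_measurable borel"
    and w: "w \<in> borel_measurable borel" "\<And>x. 0 \<le> w x"
    and eq: "distr (needle_mu \<rho> \<nu>) borel b = density lborel (\<lambda>x. ennreal (w x))"
    and int: "integrable \<nu> \<rho>" "integrable \<nu> (\<lambda>x. b x * \<rho> x)" "integrable \<nu> (\<lambda>x. (b x)\<^sup>2 * \<rho> x)"
    and mean: "(LINT x:L|\<nu>. b x * \<rho> x) = 0"
  defines "M \<equiv> measure (needle_mu \<rho> \<nu>) L"
  shows "integrable lborel w" "integrable lborel (\<lambda>x. x * w x)" "integrable lborel (\<lambda>x. x\<^sup>2 * w x)"
    and "(\<integral>x. x * w x \<partial>lborel) = 0" "(\<integral>x. w x \<partial>lborel) = M"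
    and "(\<integral>x. x\<^sup>2 * w x \<partial>lborel) = (LINT x:L|needle_mu \<rho> \<nu>. (b x)\<^sup>2)"
    and "(LINT x:{..a}|lborel. w x) = measure (needle_mu \<rho> \<nu>) {x. b x \<le> a}"
    and "needle_cdf b L (needle_mu \<rho> \<nu>) a = (LINT x:{..a}|lborel. w x) / M"
proof -
  note [measurable_cong] = \<nu>(1)
  note [measurable] = \<rho>(1) b w(1)
  note transfer = needle_transfer[OF \<nu>(1) \<rho> b w eq]
  have L: "L \<in> sets \<nu>" using \<nu>(3) emeasure_notin_sets by fastforce
  have b': "b \<in> measurable (needle_mu \<rho> \<nu>) borel" by (simp add: needle_mu_def)
  have space: "space (needle_mu \<rho> \<nu>) = UNIV" using sets_eq_imp_space_eq[OF \<nu>(1)] by (simp add: needle_mu_def)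
  show "integrable lborel w" using transfer(1)[of "\<lambda>_. 1"] int(1) by simp
  show "integrable lborel (\<lambda>x. x * w x)" using transfer(1)[of "\<lambda>x. x"] int(2) by simp
  show "integrable lborel (\<lambda>x. x\<^sup>2 * w x)" using transfer(1)[of "\<lambda>x. x\<^sup>2"] int(3) by simp
  show "(\<integral>x. x * w x \<partial>lborel) = 0"
    using transfer(2)[of "\<lambda>x. x"] mean set_integral_full_measure[OF \<nu>(2,3), of "\<lambda>x. b x * \<rho> x"] by simp
  have M: "M = (LINT x:L|\<nu>. \<rho> x)"
    unfolding M_def needle_mu_def using \<rho> L by (intro measure_density_eq_set_integral) auto
  then show "(\<integral>x. w x \<partial>lborel) = M"
    using transfer(2)[of "\<lambda>_. 1"] set_integral_full_measure[OF \<nu>(2,3), of \<rho>] by simp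
  have "(LINT x:L|needle_mu \<rho> \<nu>. (b x)\<^sup>2) = (LINT x:L|\<nu>. (b x)\<^sup>2 * \<rho> x)"
    unfolding set_lebesgue_integral_def needle_mu_def using L \<rho>(2)
    by (subst integral_density) (auto simp: ac_simps)
  then show "(\<integral>x. x\<^sup>2 * w x \<partial>lborel) = (LINT x:L|needle_mu \<rho> \<nu>. (b x)\<^sup>2)"
    using transfer(2)[of "\<lambda>x. x\<^sup>2"] set_integral_full_measure[OF \<nu>(2,3), of "\<lambda>x. (b x)\<^sup>2 * \<rho> x"] by simp
  have "(LINT x:{..a}|lborel. w x) = measure (density lborel (\<lambda>x. ennreal (w x))) {..a}"
    using w by (intro measure_density_eq_set_integral[symmetric]) auto
  also have "\<dots> = measure (needle_mu \<rho> \<nu>) {x. b x \<le> a}"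
    unfolding eq[symmetric] using b' by (subst measure_distr) (auto simp: space vimage_def)
  finally show *: "(LINT x:{..a}|lborel. w x) = measure (needle_mu \<rho> \<nu>) {x. b x \<le> a}" .
  have "b \<in> measurable (scale_measure (ennreal (1 / M)) (needle_mu \<rho> \<nu>)) borel"
    using b' by (simp add: measurable_def space_scale_measure)
  then show "needle_cdf b L (needle_mu \<rho> \<nu>) a = (LINT x:{..a}|lborel. w x) / M"
    unfolding needle_cdf_def cdf_def * M_def
    by (subst measure_distr) (auto simp: space space_scale_measure vimage_def)
qed

section \<open>Disintegration and the choice of needles\<close>

lemma localization_disintegration:
  fixes m :: "'a::metric_space measure" and \<phi> :: "'a \<Rightarrow> real"
  assumes "localization m \<rho> N \<gamma> Z Q L mq w"
    and "integrable m \<phi>" "AE x in m. x \<notin> measure_supp (density m (\<lambda>x. ennreal (\<rho> x))) \<longrightarrow> \<phi> x = 0"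
  shows "AE q in Q. integrable (mq q) \<phi>" "integrable Q (\<lambda>q. LINT x:L q|mq q. \<phi> x)"
    "(LINT x:measure_supp (density m (\<lambda>x. ennreal (\<rho> x)))|m. \<phi> x) = (LINT q|Q. (LINT x:L q|mq q. \<phi> x))"
proof -
  have "\<forall>\<phi> :: 'a \<Rightarrow> real. integrable m \<phi> \<and>
      (AE x in m. x \<notin> measure_supp (density m (\<lambda>x. ennreal (\<rho> x))) \<longrightarrow> \<phi> x = 0) \<longrightarrow>
        (AE q in Q. integrable (mq q) \<phi>) \<and>
        integrable Q (\<lambda>q. LINT x:L q|mq q. \<phi> x) \<and>
        (LINT x:measure_supp (density m (\<lambda>x. ennreal (\<rho> x)))|m. \<phi> x) = (LINT q|Q. (LINT x:L q|mq q. \<phi> x))"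
    using assms(1) unfolding localization_def Let_def by (elim conjE) assumption
  from this[rule_format, OF conjI[OF assms(2,3)]]
  show "AE q in Q. integrable (mq q) \<phi>" "integrable Q (\<lambda>q. LINT x:L q|mq q. \<phi> x)"
    "(LINT x:measure_supp (density m (\<lambda>x. ennreal (\<rho> x)))|m. \<phi> x) = (LINT q|Q. (LINT x:L q|mq q. \<phi> x))"
    by blast+
qed

lemma localization_needle:
  assumes "localization m \<rho> N \<gamma> Z Q L mq w" "q \<in> space Q"
  shows "prob_space (mq q)" "sets (mq q) = sets borel" "emeasure (mq q) (L q) = 1"
proof -
  have "\<forall>q\<in>space Q. (\<exists>I \<eta>. arclength_param (L q) I \<eta>) \<and>
     prob_space (mq q) \<and> sets (mq q) = sets borel \<and> emeasure (mq q) (L q) = 1"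
    using assms(1) unfolding localization_def Let_def by (elim conjE) assumption
  with assms(2) show "prob_space (mq q)" "sets (mq q) = sets borel" "emeasure (mq q) (L q) = 1" by blast+
qed

lemma localization_Union_sets:
  assumes "localization m \<rho> N \<gamma> Z Q L mq w" "S \<in> sets Q"
  shows "(\<Union>q\<in>S. L q) \<in> sets (completion m)"
proof -
  have "\<forall>S\<in>sets Q. (\<Union>q\<in>S. L q) \<in> sets (completion m)"
    using assms(1) unfolding localization_def Let_def by (elim conjE) assumption
  with assms(2) show ?thesis by blast
qed

text \<open>Disintegration is granted only for integrands vanishing off the support; a factor
  \<open>\<rho>\<close> ensures this.\<close>

lemma AE_zero_off_measure_supp:
  fixes m :: "'a::second_countable_topology measure" and \<rho> :: "'a \<Rightarrow> real"
  assumes m: "sets m = sets borel" and \<rho>: "\<rho> \<in> borel_measurable borel" "\<And>x. 0 \<le> \<rho> x"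
  shows "AE x in m. x \<notin> measure_supp (density m (\<lambda>x. ennreal (\<rho> x))) \<longrightarrow> \<rho> x = 0"
proof -
  note [measurable_cong] = m
  note [measurable] = \<rho>(1)
  have "- measure_supp (density m (\<lambda>x. ennreal (\<rho> x))) \<in> null_sets (density m (\<lambda>x. ennreal (\<rho> x)))"
    by (rule measure_supp_null) (simp add: m)
  then have "AE x in m. x \<in> - measure_supp (density m (\<lambda>x. ennreal (\<rho> x))) \<longrightarrow> ennreal (\<rho> x) = 0"
    by (subst (asm) null_sets_density_iff) auto
  then show ?thesis
    using \<rho>(2) by (auto elim!: eventually_mono intro: antisym)
qed

text \<open>Markov's inequality in integrated form: almost everywhere,
  \<open>I UNIV q - I B q / r\<close> is at most the mass of the needle if it is selected and at
  most 0 if it is rejected. Its integral over \<open>Q\<close> is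
  \<open>1 - measure \<mu> B / r\<close>, hence at least
  \<open>\<delta> / (1 + \<delta>)\<close>.\<close>

lemma needle_selection:
  fixes m :: "'a::{metric_space, second_countable_topology} measure" and \<rho> :: "'a \<Rightarrow> real"
  defines "\<mu> \<equiv> density m (\<lambda>x. ennreal (\<rho> x))"
  assumes m: "sets m = sets borel" and \<rho>: "\<rho> \<in> borel_measurable borel" "\<And>x. 0 \<le> \<rho> x"
    and \<mu>: "prob_space \<mu>" and B: "B \<in> sets borel"
    and loc: "localization m \<rho> N \<gamma> Z Q L mq w"
    and P: "AE q in Q. P q"
    and pos: "0 < \<kappa>" "0 < \<epsilon>" "0 < \<delta>" and le: "measure \<mu> B \<le> (1 + \<epsilon>) * \<kappa>"
  obtains Q' where "Q' \<subseteq> space Q" "\<And>q. q \<in> Q' \<Longrightarrow> P q"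
    "\<And>q. q \<in> Q' \<Longrightarrow> 0 < measure (needle_mu \<rho> (mq q)) (L q)"
    "\<And>q. q \<in> Q' \<Longrightarrow> measure (needle_mu \<rho> (mq q)) B
        \<le> (1 + (\<epsilon> + \<delta> + \<epsilon> * \<delta>)) * \<kappa> * measure (needle_mu \<rho> (mq q)) (L q)"
    "(\<Union>q\<in>Q'. L q) \<in> sets (completion \<mu>)"
    "\<delta> / (1 + \<delta>) \<le> measure (completion \<mu>) (\<Union>q\<in>Q'. L q)"
proof -
  note [measurable_cong] = m
  note [measurable] = \<rho>(1) B
  interpret \<mu>: prob_space \<mu> by fact
  define r where "r = (1 + (\<epsilon> + \<delta> + \<epsilon> * \<delta>)) * \<kappa>"
  have r: "r = (1 + \<delta>) * ((1 + \<epsilon>) * \<kappa>)" "0 < r" using pos by (auto simp: r_def algebra_simps add_pos_pos)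
  have mq: "prob_space (mq q)" "sets (mq q) = sets borel" "emeasure (mq q) (L q) = 1" if "q \<in> space Q" for q
    using localization_needle[OF loc that] by blast+
  have sets_\<mu>: "sets \<mu> = sets borel" by (simp add: \<mu>_def m)
  note off_supp = AE_zero_off_measure_supp[OF m \<rho>, folded \<mu>_def]
  have supp: "measure_supp \<mu> \<in> sets borel"
    using measure_supp_null[OF sets_\<mu>] sets_\<mu> by (metis borel_comp double_complement null_setsD2)
  define I where "I = (\<lambda>S q. LINT x:L q|mq q. \<rho> x * indicator S x)"
  have disint: "(AE q in Q. integrable (mq q) (\<lambda>x. \<rho> x * indicator S x))"
      "integrable Q (I S)" "(\<integral>q. I S q \<partial>Q) = measure \<mu> S" if S: "S \<in> sets borel" for S
  proof -
    note [measurable] = S supp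
    let ?\<phi> = "\<lambda>x. \<rho> x * indicator S x"
    have "integrable \<mu> (indicator S :: 'a \<Rightarrow> real)" by (simp add: S sets_\<mu> \<mu>.emeasure_eq_measure)
    then have int: "integrable m ?\<phi>"
      unfolding \<mu>_def using \<rho> by (subst (asm) integrable_density) auto
    have off: "AE x in m. x \<notin> measure_supp \<mu> \<longrightarrow> ?\<phi> x = 0" using off_supp by eventually_elim auto
    have "(LINT x:measure_supp \<mu>|m. ?\<phi> x) = (LINT x|m. ?\<phi> x)"
      unfolding set_lebesgue_integral_def
      by (rule integral_cong_AE) (use off in \<open>auto elim!: eventually_mono simp: indicator_def\<close>)
    also have "\<dots> = measure \<mu> S"
      unfolding \<mu>_def using \<rho> m S
      by (subst measure_density_eq_set_integral) (auto simp: set_lebesgue_integral_def mult.commute)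
    finally have "(LINT x:measure_supp \<mu>|m. ?\<phi> x) = measure \<mu> S" .
    with localization_disintegration[OF loc int off[unfolded \<mu>_def]]
    show "AE q in Q. integrable (mq q) ?\<phi>" "integrable Q (I S)" "(\<integral>q. I S q \<partial>Q) = measure \<mu> S"
      by (simp_all add: I_def \<mu>_def)
  qed
  have I_nonneg: "0 \<le> I S q" for S q
    unfolding I_def set_lebesgue_integral_def using \<rho>(2) by (intro integral_nonneg_AE) auto
  have I_eq: "measure (needle_mu \<rho> (mq q)) (S \<inter> L q) = I S q" if "q \<in> space Q" "S \<in> sets borel" for S q
  proof -
    have [measurable_cong]: "sets (mq q) = sets borel" by (rule mq(2)[OF that(1)])
    have "L q \<in> sets (mq q)" using mq(3)[OF that(1)] emeasure_notin_sets by fastforce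
    then have "measure (needle_mu \<rho> (mq q)) (S \<inter> L q) = (LINT x:S \<inter> L q|mq q. \<rho> x)"
      unfolding needle_mu_def using \<rho> that mq(2)[OF that(1)] by (intro measure_density_eq_set_integral) auto
    then show ?thesis
      unfolding I_def set_lebesgue_integral_def
      by (auto intro!: Bochner_Integration.integral_cong simp: indicator_def)
  qed
  have I_mass: "measure (needle_mu \<rho> (mq q)) (L q) = I UNIV q" if "q \<in> space Q" for q
    using I_eq[OF that, of UNIV] by simp
  have I_B: "measure (needle_mu \<rho> (mq q)) B = I B q" if "q \<in> space Q" for q
  proof -
    have [measurable_cong]: "sets (mq q) = sets borel" by (rule mq(2)[OF that])
    have "measure (needle_mu \<rho> (mq q)) B = (LINT x:B|mq q. \<rho> x)"
      unfolding needle_mu_def using \<rho> by (intro measure_density_eq_set_integral) auto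
    also have "\<dots> = (LINT x|mq q. \<rho> x * indicator B x)"
      by (simp add: set_lebesgue_integral_def mult.commute)
    also have "\<dots> = I B q"
      unfolding I_def using mq[OF that] by (intro set_integral_full_measure[symmetric]) auto
    finally show ?thesis .
  qed
  \<comment> \<open>The set where \<open>P\<close> fails need not be measurable; removing a
    measurable null superset keeps \<open>Q'\<close> measurable.\<close>
  obtain N0 where N0: "{q \<in> space Q. \<not> P q} \<subseteq> N0" "N0 \<in> null_sets Q"
    using P by (auto elim!: AE_E simp: null_setsI)
  have [measurable]: "I UNIV \<in> borel_measurable Q" "I B \<in> borel_measurable Q"
    using disint(2) B by auto
  define Q' where "Q' = {q \<in> space Q. 0 < I UNIV q \<and> I B q \<le> r * I UNIV q} - N0"
  have Q'_sets: "Q' \<in> sets Q" unfolding Q'_def using N0 by auto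
  have Q'_space: "Q' \<subseteq> space Q" by (auto simp: Q'_def)
  define U where "U = (\<Union>q\<in>Q'. L q)"
  have "U \<in> sets (completion m)" unfolding U_def by (rule localization_Union_sets[OF loc Q'_sets])
  \<comment> \<open>The union of needles is measurable only up to null sets, whereas disintegration
    is applied to Borel sets. Hence the sandwich
    \<open>S \<subseteq> U \<subseteq> S \<union> N'\<close>: the outer set enters the integral
    estimate, the inner one the conclusion, and they have equal \<mu>-measure because \<mu> is
    absolutely continuous with respect to \<open>m\<close>.\<close>
  then obtain S N N' where U: "U = S \<union> N" "N \<subseteq> N'" "N' \<in> null_sets m" "S \<in> sets m"
    by (rule sets_completionE)
  have N': "N' \<in> null_sets \<mu>"
    unfolding \<mu>_def using U(3) by (subst null_sets_density_iff) (auto dest: AE_not_in elim: eventually_mono)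
  have U_sets: "U \<in> sets (completion \<mu>)"
    using U(1,2,4) N' m sets_\<mu> by (intro sets_completionI[of U S N N']) auto
  have "(\<integral>q. I UNIV q - I B q / r \<partial>Q) \<le> (\<integral>q. I (S \<union> N') q \<partial>Q)"
  proof (rule integral_mono_AE)
    have SN: "S \<union> N' \<in> sets borel" using U m by auto
    show "integrable Q (\<lambda>q. I UNIV q - I B q / r)" "integrable Q (I (S \<union> N'))"
      using disint(2) SN B by auto
    show "AE q in Q. I UNIV q - I B q / r \<le> I (S \<union> N') q"
      using AE_not_in[OF N0(2)] AE_space
    proof eventually_elim
      case (elim q)
      show ?case
      proof (cases "q \<in> Q'")
        case True
        then have "L q \<subseteq> S \<union> N'" using U by (auto simp: U_def)
        then have "I UNIV q = I (S \<union> N') q"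
          unfolding I_def set_lebesgue_integral_def
          by (intro Bochner_Integration.integral_cong refl) (auto simp: indicator_def subset_iff)
        then show ?thesis using I_nonneg[of B q] r(2) by simp
      next
        case False
        then have "I UNIV q = 0 \<or> r * I UNIV q < I B q"
          using elim I_nonneg[of UNIV q] by (auto simp: Q'_def)
        then have "I UNIV q \<le> I B q / r"
          using I_nonneg[of B q] r(2) by (auto simp: field_simps)
        then show ?thesis using I_nonneg[of "S \<union> N'" q] by simp
      qed
    qed
  qed
  also have "\<dots> = measure \<mu> (S \<union> N')" using disint(3)[of "S \<union> N'"] U m by auto
  also have "\<dots> = measure \<mu> S"
    using N' U(4) m sets_\<mu> by (intro measure_Un_null_set) auto
  also have "\<dots> = measure (completion \<mu>) S" using U(4) m sets_\<mu> by simp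
  also have "\<dots> \<le> measure (completion \<mu>) U"
  proof (rule measure_mono_fmeasurable)
    show "U \<in> fmeasurable (completion \<mu>)"
      using U_sets \<mu>.emeasure_finite by (auto simp: fmeasurable_def less_top[symmetric])
  qed (use U m sets_\<mu> in auto)
  finally have "(\<integral>q. I UNIV q - I B q / r \<partial>Q) \<le> measure (completion \<mu>) U" .
  moreover have "(\<integral>q. I UNIV q - I B q / r \<partial>Q) = 1 - measure \<mu> B / r"
    using disint(2,3)[of UNIV] disint(2,3)[OF B] \<mu>.prob_space sets_eq_imp_space_eq[OF sets_\<mu>] by simp
  moreover have "measure \<mu> B / r \<le> 1 / (1 + \<delta>)"
    using le pos by (simp add: r divide_simps mult.commute)
  moreover have "1 - 1 / (1 + \<delta>) = \<delta> / (1 + \<delta>)" using pos by (simp add: field_simps)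
  ultimately have "\<delta> / (1 + \<delta>) \<le> measure (completion \<mu>) U" by linarith
  with U_sets show thesis
    using Q'_space N0(1) I_mass I_B by (intro that[of Q']) (auto simp: U_def Q'_def r_def)
qed

lemma localization_AE_density:
  fixes \<gamma> :: "real \<Rightarrow> 'a::metric_space"
  assumes "localization m \<rho> N \<gamma> Z Q L mq w"
  shows "AE q in Q. (LINT x:L q|mq q. busemann \<gamma> x * \<rho> x) = 0"
    "AE q in Q. 0 < measure (needle_mu \<rho> (mq q)) (L q) \<longrightarrow>
       w q \<in> borel_measurable borel \<and> (\<forall>x. 0 \<le> w q x) \<and>
       distr (needle_mu \<rho> (mq q)) borel (busemann \<gamma>) = density lborel (\<lambda>x. ennreal (w q x))"
proof -
  have "AE q in Q. (LINT x:L q|mq q. busemann \<gamma> x * \<rho> x) = 0 \<and> needle_CD0 N (L q) (mq q)"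
    using assms unfolding localization_def Let_def by (elim conjE) assumption
  then show "AE q in Q. (LINT x:L q|mq q. busemann \<gamma> x * \<rho> x) = 0" by eventually_elim blast
  have "AE q in Q. measure (needle_mu \<rho> (mq q)) (L q) > 0 \<longrightarrow>
        inj_on (busemann \<gamma>) (L q) \<and>
        w q \<in> borel_measurable borel \<and> (\<forall>x. w q x \<ge> 0) \<and> (\<forall>x. x \<notin> busemann \<gamma> ` L q \<longrightarrow> w q x = 0) \<and>
        distr (needle_mu \<rho> (mq q)) borel (busemann \<gamma>) = density lborel (\<lambda>x. ennreal (w q x))"
    using assms unfolding localization_def Let_def by (elim conjE) assumption
  then show "AE q in Q. 0 < measure (needle_mu \<rho> (mq q)) (L q) \<longrightarrow>
       w q \<in> borel_measurable borel \<and> (\<forall>x. 0 \<le> w q x) \<and>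
       distr (needle_mu \<rho> (mq q)) borel (busemann \<gamma>) = density lborel (\<lambda>x. ennreal (w q x))"
    by eventually_elim blast
qed

lemma localization_AE_shape:
  assumes "localization m \<rho> N \<gamma> Z Q L mq w"
  shows "\<lbrakk>- \<infinity> < N; N < ereal \<beta>; \<beta> < -1;
      geodesically_concave (powr_on_positive (1 / (\<beta> - real_of_ereal N)) \<rho>)\<rbrakk> \<Longrightarrow>
    AE q in Q. 0 < measure (needle_mu \<rho> (mq q)) (L q) \<longrightarrow> convex_powr (1 / (\<beta> - 1)) (w q)"
    "\<lbrakk>N = \<infinity>; geodesically_concave (ln_on_positive \<rho>)\<rbrakk> \<Longrightarrow>
    AE q in Q. 0 < measure (needle_mu \<rho> (mq q)) (L q) \<longrightarrow> log_concave (w q)"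
proof -
  have "\<forall>\<beta>. - \<infinity> < N \<and> N < ereal \<beta> \<and> \<beta> < -1 \<and>
        geodesically_concave (powr_on_positive (1 / (\<beta> - real_of_ereal N)) \<rho>) \<longrightarrow>
        (AE q in Q. measure (needle_mu \<rho> (mq q)) (L q) > 0 \<longrightarrow> convex_powr (1 / (\<beta> - 1)) (w q))"
    using assms unfolding localization_def Let_def by (elim conjE) assumption
  then show "\<lbrakk>- \<infinity> < N; N < ereal \<beta>; \<beta> < -1;
      geodesically_concave (powr_on_positive (1 / (\<beta> - real_of_ereal N)) \<rho>)\<rbrakk> \<Longrightarrow>
    AE q in Q. 0 < measure (needle_mu \<rho> (mq q)) (L q) \<longrightarrow> convex_powr (1 / (\<beta> - 1)) (w q)"
    by blast
  have "N = \<infinity> \<and> geodesically_concave (ln_on_positive \<rho>) \<longrightarrow>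
        (AE q in Q. measure (needle_mu \<rho> (mq q)) (L q) > 0 \<longrightarrow> log_concave (w q))"
    using assms unfolding localization_def Let_def by (elim conjE) assumption
  then show "\<lbrakk>N = \<infinity>; geodesically_concave (ln_on_positive \<rho>)\<rbrakk> \<Longrightarrow>
    AE q in Q. 0 < measure (needle_mu \<rho> (mq q)) (L q) \<longrightarrow> log_concave (w q)" by blast
qed

text \<open>A Busemann function is 1-Lipschitz, so its square grows at most like the squared
  distance to \<open>z\<close>, which has finite integral by \<open>in_P2\<close>.\<close>

lemma P2_busemann_moments:
  fixes m :: "'a::metric_space measure" and \<rho> :: "'a \<Rightarrow> real"
  assumes m: "sets m = sets borel" and \<rho>: "\<rho> \<in> borel_measurable borel" "\<And>x. 0 \<le> \<rho> x"
    and P2: "in_P2 (density m (\<lambda>x. ennreal (\<rho> x)))" and "straight_line \<gamma>"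
  shows "integrable m \<rho>" "integrable m (\<lambda>x. busemann \<gamma> x * \<rho> x)"
    "integrable m (\<lambda>x. (busemann \<gamma> x)\<^sup>2 * \<rho> x)"
proof -
  note [measurable_cong] = m
  note [measurable] = \<rho>(1) busemann_measurable[OF \<open>straight_line \<gamma>\<close>]
  define \<mu> where "\<mu> = density m (\<lambda>x. ennreal (\<rho> x))"
  have [measurable_cong]: "sets \<mu> = sets borel" by (simp add: \<mu>_def m)
  interpret prob_space \<mu> using P2 by (simp add: in_P2_def \<mu>_def)
  obtain z where z: "integrable \<mu> (\<lambda>x. (dist z x)\<^sup>2)" using P2 by (auto simp: in_P2_def \<mu>_def)
  let ?b = "busemann \<gamma>"
  have b2: "integrable \<mu> (\<lambda>x. (?b x)\<^sup>2)"
  proof (rule Bochner_Integration.integrable_bound)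
    show "integrable \<mu> (\<lambda>x. 2 * (?b z)\<^sup>2 + 2 * (dist z x)\<^sup>2)" using z by simp
    have "(?b x)\<^sup>2 \<le> 2 * (?b z)\<^sup>2 + 2 * (dist z x)\<^sup>2" for x
    proof -
      have "\<bar>?b z - ?b x\<bar>\<^sup>2 \<le> (dist z x)\<^sup>2"
        using busemann_lipschitz[OF \<open>straight_line \<gamma>\<close>] by (intro power_mono) auto
      \<comment> \<open>The right-hand side exceeds the left-hand side by
        \<open>(2 * ?b z - ?b x)\<^sup>2\<close>.\<close>
      moreover have "(?b x)\<^sup>2 \<le> 2 * (?b z)\<^sup>2 + 2 * (?b z - ?b x)\<^sup>2"
        using zero_le_power2[of "2 * ?b z - ?b x"] by (simp add: power2_eq_square algebra_simps)
      ultimately show ?thesis by simp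
    qed
    then show "AE x in \<mu>. norm ((?b x)\<^sup>2) \<le> norm (2 * (?b z)\<^sup>2 + 2 * (dist z x)\<^sup>2)"
      by (auto simp: abs_of_nonneg)
  qed simp
  have b1: "integrable \<mu> ?b"
  proof (rule Bochner_Integration.integrable_bound)
    show "integrable \<mu> (\<lambda>x. 1 + (?b x)\<^sup>2)" using b2 by simp
    have "\<bar>y\<bar> \<le> 1 + y\<^sup>2" for y :: real
      using zero_le_power2[of "\<bar>y\<bar> - 1"] by (simp add: power2_eq_square algebra_simps)
    then show "AE x in \<mu>. norm (?b x) \<le> norm (1 + (?b x)\<^sup>2)" by (auto simp: abs_of_nonneg)
  qed simp
  have transfer: "integrable m (\<lambda>x. f x * \<rho> x)" if "integrable \<mu> f" "f \<in> borel_measurable borel"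
    for f :: "'a \<Rightarrow> real"
    using that \<rho>(2) unfolding \<mu>_def by (subst (asm) integrable_density) (auto simp: mult.commute)
  show "integrable m \<rho>" using transfer[of "\<lambda>_. 1"] by simp
  show "integrable m (\<lambda>x. ?b x * \<rho> x)" by (rule transfer[OF b1]) measurable
  show "integrable m (\<lambda>x. (?b x)\<^sup>2 * \<rho> x)" by (rule transfer[OF b2]) measurable
qed

text \<open>Common frame of both parts: \<open>C\<close> is the shape of the needle densities,
  \<open>F\<close> the model with given rate, and \<open>D\<close> the bound in terms of density,
  mass and second moment. The premise \<open>concl\<close> is the one-dimensional stability
  statement, to be applied on each selected needle.\<close>

lemma stable_needles:
  fixes m :: "'a::{metric_space, second_countable_topology} measure" and \<rho> :: "'a \<Rightarrow> real"
  defines "\<mu> \<equiv> density m (\<lambda>x. ennreal (\<rho> x))"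
  assumes m: "sets m = sets borel" and \<rho>: "\<rho> \<in> borel_measurable borel" "\<And>x. 0 \<le> \<rho> x"
    and P2: "in_P2 \<mu>" and \<gamma>: "straight_line \<gamma>"
    and loc: "localization m \<rho> N \<gamma> Z Q L mq w"
    and C: "AE q in Q. 0 < measure (needle_mu \<rho> (mq q)) (L q) \<longrightarrow> C (w q)"
    and pos: "0 < \<kappa>" "0 < \<epsilon>" "0 < \<delta>"
    and le: "measure \<mu> {x. busemann \<gamma> x \<le> 0} \<le> (1 + \<epsilon>) * \<kappa>"
    and concl: "\<And>v M. \<lbrakk>C v; 0 < M; integrable lborel v; integrable lborel (\<lambda>x. x * v x);
        integrable lborel (\<lambda>x. x\<^sup>2 * v x); (\<integral>x. x * v x \<partial>lborel) = 0; (\<integral>x. v x \<partial>lborel) = M;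
        \<And>x. 0 \<le> v x; (LINT x:{..0}|lborel. v x) \<le> (1 + (\<epsilon> + \<delta> + \<epsilon> * \<delta>)) * \<kappa> * M\<rbrakk> \<Longrightarrow>
        (\<integral>\<^sup>+x. ennreal \<bar>(LINT y:{..x}|lborel. v y) / M - F (needle_c v) x\<bar> \<partial>lborel)
          \<le> D v M (\<integral>x. x\<^sup>2 * v x \<partial>lborel)"
  shows "\<exists>Q'\<subseteq>space Q.
           (\<forall>q\<in>Q'. measure (needle_mu \<rho> (mq q)) (L q) > 0) \<and>
           (\<Union>q\<in>Q'. L q) \<in> sets (completion \<mu>) \<and>
           measure (completion \<mu>) (\<Union>q\<in>Q'. L q) \<ge> \<delta> / (1 + \<delta>) \<and>
           (\<forall>q\<in>Q'. (\<integral>\<^sup>+x. ennreal \<bar>needle_cdf (busemann \<gamma>) (L q) (needle_mu \<rho> (mq q)) x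
                       - F (needle_c (w q)) x\<bar> \<partial>lborel)
              \<le> D (w q) (measure (needle_mu \<rho> (mq q)) (L q))
                  (LINT x:L q|needle_mu \<rho> (mq q). (busemann \<gamma> x)\<^sup>2))"
proof -
  note b = busemann_measurable[OF \<gamma>]
  note moments = P2_busemann_moments[OF m \<rho> P2[unfolded \<mu>_def] \<gamma>]
  have int: "AE q in Q. integrable (mq q) (\<lambda>x. f x * \<rho> x)" if "integrable m (\<lambda>x. f x * \<rho> x)" for f
  proof (rule localization_disintegration(1)[OF loc that])
    show "AE x in m. x \<notin> measure_supp (density m (\<lambda>x. ennreal (\<rho> x))) \<longrightarrow> f x * \<rho> x = 0"
      using AE_zero_off_measure_supp[OF m \<rho>] by eventually_elim auto
  qed
  let ?\<nu> = "\<lambda>q. needle_mu \<rho> (mq q)"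
  \<comment> \<open>All almost-everywhere properties are bundled so that the selection yields
    needles on which every one of them holds, as the conclusion is about every
    \<open>q \<in> Q'\<close>.\<close>
  define P where "P q \<longleftrightarrow> integrable (mq q) \<rho> \<and> integrable (mq q) (\<lambda>x. busemann \<gamma> x * \<rho> x) \<and>
      integrable (mq q) (\<lambda>x. (busemann \<gamma> x)\<^sup>2 * \<rho> x) \<and>
      (LINT x:L q|mq q. busemann \<gamma> x * \<rho> x) = 0 \<and>
      (0 < measure (?\<nu> q) (L q) \<longrightarrow> C (w q) \<and> w q \<in> borel_measurable borel \<and> (\<forall>x. 0 \<le> w q x) \<and>
        distr (?\<nu> q) borel (busemann \<gamma>) = density lborel (\<lambda>x. ennreal (w q x)))" for q
  have "AE q in Q. integrable (mq q) \<rho>" using int[of "\<lambda>_. 1"] moments(1) by simp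
  then have AE_P: "AE q in Q. P q"
    using int[OF moments(2)] int[OF moments(3)]
      localization_AE_density(1)[OF loc] localization_AE_density(2)[OF loc] C
    by eventually_elim (simp add: P_def)
  have prob: "prob_space (density m (\<lambda>x. ennreal (\<rho> x)))" using P2 by (simp add: in_P2_def \<mu>_def)
  have B: "{x. busemann \<gamma> x \<le> 0} \<in> sets borel"
    using b by (simp add: borel_measurable_iff_le)
  note selection = needle_selection[OF m \<rho> prob B loc AE_P pos le[unfolded \<mu>_def], folded \<mu>_def]
  obtain Q' where Q': "Q' \<subseteq> space Q" "\<And>q. q \<in> Q' \<Longrightarrow> P q"
    "\<And>q. q \<in> Q' \<Longrightarrow> 0 < measure (?\<nu> q) (L q)"
    "\<And>q. q \<in> Q' \<Longrightarrow> measure (?\<nu> q) {x. busemann \<gamma> x \<le> 0}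
        \<le> (1 + (\<epsilon> + \<delta> + \<epsilon> * \<delta>)) * \<kappa> * measure (?\<nu> q) (L q)"
    "(\<Union>q\<in>Q'. L q) \<in> sets (completion \<mu>)"
    "\<delta> / (1 + \<delta>) \<le> measure (completion \<mu>) (\<Union>q\<in>Q'. L q)"
    by (rule selection) (rule that)
  have "(\<integral>\<^sup>+x. ennreal \<bar>needle_cdf (busemann \<gamma>) (L q) (?\<nu> q) x - F (needle_c (w q)) x\<bar> \<partial>lborel)
      \<le> D (w q) (measure (?\<nu> q) (L q)) (LINT x:L q|?\<nu> q. (busemann \<gamma> x)\<^sup>2)" if q: "q \<in> Q'" for q
  proof -
    have P: "integrable (mq q) \<rho>" "integrable (mq q) (\<lambda>x. busemann \<gamma> x * \<rho> x)"
      "integrable (mq q) (\<lambda>x. (busemann \<gamma> x)\<^sup>2 * \<rho> x)"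
      "(LINT x:L q|mq q. busemann \<gamma> x * \<rho> x) = 0"
      "C (w q)" "w q \<in> borel_measurable borel" "\<And>x. 0 \<le> w q x"
      "distr (?\<nu> q) borel (busemann \<gamma>) = density lborel (\<lambda>x. ennreal (w q x))"
      using Q'(2,3)[OF q] by (auto simp: P_def)
    have "q \<in> space Q" using Q'(1) q by blast
    note mq = localization_needle[OF loc this]
    note facts = needle_density_facts[OF mq(2,1,3) \<rho> b P(6,7,8) P(1-4)]
    show ?thesis
      unfolding facts(8) facts(6)[symmetric]
      by (rule concl[OF P(5) Q'(3)[OF q] facts(1-5) P(7)]) (use Q'(4)[OF q] in \<open>simp add: facts(7)\<close>)
  qed
  with Q' show ?thesis by blast
qed

theorem proposition6p6:
  fixes A :: "('a::{metric_space, second_countable_topology}, 'n::finite) chart set"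
    and g :: "('a, 'n) metric"
    and vol m \<mu> :: "'a measure"
    and \<psi> \<rho> :: "'a \<Rightarrow> real"
    and N :: ereal
    and x0 :: 'a
    and \<gamma> :: "real \<Rightarrow> 'a"
    and Z :: "'a set"
    and Q :: "'q measure"
    and L :: "'q \<Rightarrow> 'a set"
    and mq :: "'q \<Rightarrow> 'a measure"
    and w :: "'q \<Rightarrow> real \<Rightarrow> real"
    and \<epsilon> :: real
  assumes "riemannian_manifold A g" and "complete (UNIV :: 'a set)"
    and "riemannian_volume A g vol"
    and "C2_on_manifold A \<psi>" and "bdd_above (range \<psi>)"
    and "m = density vol (\<lambda>x. ennreal (exp (- \<psi> x)))"
    and "N = \<infinity> \<or> - \<infinity> < N \<and> N < -1"
    and "nonneg_weighted_ricci A g \<psi> N"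
    and "\<rho> \<in> borel_measurable borel" and "\<And>x. \<rho> x \<ge> 0"
    and "\<mu> = density m (\<lambda>x. ennreal (\<rho> x))" and "in_P2 \<mu>"
    and "is_barycenter \<mu> x0"
    and "straight_line \<gamma>" and "busemann \<gamma> x0 = 0"
    and "localization m \<rho> N \<gamma> Z Q L mq w"
    and "\<epsilon> > 0"
  shows
    "(\<forall>\<beta>::real.
        - \<infinity> < N \<and> N < -1 \<and> N < ereal \<beta> \<and> \<beta> < -1 \<and>
        geodesically_concave (powr_on_positive (1 / (\<beta> - real_of_ereal N)) \<rho>) \<and>
        measure \<mu> {x. busemann \<gamma> x \<le> 0} \<le> (1 + \<epsilon>) * (\<beta> / (\<beta> + 1)) powr \<beta> \<longrightarrow>
        (\<forall>\<delta>>0. \<exists>Q'\<subseteq>space Q.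
           (\<forall>q\<in>Q'. measure (needle_mu \<rho> (mq q)) (L q) > 0) \<and>
           (\<Union>q\<in>Q'. L q) \<in> sets (completion \<mu>) \<and>
           measure (completion \<mu>) (\<Union>q\<in>Q'. L q) \<ge> \<delta> / (1 + \<delta>) \<and>
           (\<forall>q\<in>Q'. let \<epsilon>' = \<epsilon> + \<delta> + \<epsilon> * \<delta>; \<mu>q = needle_mu \<rho> (mq q); c = needle_c (w q) in
              (\<integral>\<^sup>+x. ennreal \<bar>needle_cdf (busemann \<gamma>) (L q) \<mu>q x - model_cdf_power \<beta> c x\<bar> \<partial>lborel)
              \<le> ennreal (2 * \<beta> * (\<beta> / (\<beta> + 1)) powr \<beta> * (1 + \<epsilon>') *
                         (1 - (1 + \<epsilon>') powr (- 1 / \<beta>)) * (measure \<mu>q (L q) / w q 0)))))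
     \<and>
     (N = \<infinity> \<and> geodesically_concave (ln_on_positive \<rho>) \<and>
      measure \<mu> {x. busemann \<gamma> x \<le> 0} \<le> (1 + \<epsilon>) * exp (- 1) \<longrightarrow>
        (\<forall>\<delta>>0. \<exists>Q'\<subseteq>space Q.
           (\<forall>q\<in>Q'. measure (needle_mu \<rho> (mq q)) (L q) > 0) \<and>
           (\<Union>q\<in>Q'. L q) \<in> sets (completion \<mu>) \<and>
           measure (completion \<mu>) (\<Union>q\<in>Q'. L q) \<ge> \<delta> / (1 + \<delta>) \<and>
           (\<forall>q\<in>Q'. let \<epsilon>' = \<epsilon> + \<delta> + \<epsilon> * \<delta>; \<mu>q = needle_mu \<rho> (mq q); c = needle_c (w q) in
              (\<integral>\<^sup>+x. ennreal \<bar>needle_cdf (busemann \<gamma>) (L q) \<mu>q x - model_cdf_exp c x\<bar> \<partial>lborel)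
              \<le> ennreal (4 * sqrt 3 / exp 1 * (1 + \<epsilon>') * ln (1 + \<epsilon>') *
                         sqrt (1 / measure \<mu>q (L q) * (LINT x:L q|\<mu>q. (busemann \<gamma> x)\<^sup>2))))))"
proof (intro conjI allI impI, goal_cases)
  have m: "sets m = sets borel"
    using assms(3,6) by (simp add: riemannian_volume_def)
  note \<mu> = \<open>\<mu> = density m (\<lambda>x. ennreal (\<rho> x))\<close>
  note stable = stable_needles[OF m assms(9,10) assms(12)[unfolded \<mu>] assms(14,16), folded \<mu>]
  {
    case (1 \<beta> \<delta>)
    let ?\<epsilon>' = "\<epsilon> + \<delta> + \<epsilon> * \<delta>"
    \<comment> \<open>Both \<beta> and \<open>\<beta> + 1\<close> are negative, so the base is
      positive and \<open>powr\<close> is a genuine power.\<close>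
    have "0 < (\<beta> / (\<beta> + 1)) powr \<beta>" using 1 by (simp add: divide_neg_neg)
    note \<kappa> = this
    show ?case
      unfolding Let_def
    proof (rule stable[OF _ \<kappa> \<open>\<epsilon> > 0\<close> \<open>\<delta> > 0\<close>, where C = "convex_powr (1 / (\<beta> - 1))"
        and F = "model_cdf_power \<beta>"
        and D = "\<lambda>v M V. ennreal (2 * \<beta> * (\<beta> / (\<beta> + 1)) powr \<beta> * (1 + ?\<epsilon>') *
           (1 - (1 + ?\<epsilon>') powr (- 1 / \<beta>)) * (M / v 0))"])
      show "AE q in Q. 0 < measure (needle_mu \<rho> (mq q)) (L q) \<longrightarrow> convex_powr (1 / (\<beta> - 1)) (w q)"
        using localization_AE_shape(1)[OF assms(16), of \<beta>] 1 by blast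
      show "measure \<mu> {x. busemann \<gamma> x \<le> 0} \<le> (1 + \<epsilon>) * (\<beta> / (\<beta> + 1)) powr \<beta>"
        using 1 by blast
    qed (rule power_needle_stability; use 1 \<open>\<epsilon> > 0\<close> in simp)
  next
    case (2 \<delta>)
    let ?\<epsilon>' = "\<epsilon> + \<delta> + \<epsilon> * \<delta>"
    show ?case
      unfolding Let_def
    proof (rule stable[OF _ exp_gt_zero \<open>\<epsilon> > 0\<close> \<open>\<delta> > 0\<close>, where C = log_concave and F = model_cdf_exp
        and D = "\<lambda>v M V. ennreal (4 * sqrt 3 / exp 1 * (1 + ?\<epsilon>') * ln (1 + ?\<epsilon>') * sqrt (1 / M * V))"])
      show "AE q in Q. 0 < measure (needle_mu \<rho> (mq q)) (L q) \<longrightarrow> log_concave (w q)"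
        using localization_AE_shape(2)[OF assms(16)] 2 by blast
      show "measure \<mu> {x. busemann \<gamma> x \<le> 0} \<le> (1 + \<epsilon>) * exp (- 1)"
        using 2 by blast
    qed (rule log_concave_needle_stability; use 2 \<open>\<epsilon> > 0\<close> in simp)
  }
qed

end
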